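(* Let $\mathcal{H}$ be an infinite dimensional separable complex Hilbert space, let $U\in\mathcal{B}(\mathcal{H})$ be a unitary operator, and let $\mathcal{A}\subseteq\mathcal{B}(\mathcal{H})$ be an abelian self-adjoint algebra that is invariant under conjugation by $U$, i.e. $U^*\mathcal{A}U\subseteq\mathcal{A}$. If $\mathcal{A}$ is the weak operator closure of the subalgebra of its compact operators, then there exists a maximal abelian self-adjoint subalgebra (masa) $\mathcal{B}\subseteq\mathcal{B}(\mathcal{H})$ that contains $\mathcal{A}$ and is also invariant under conjugation by $U$, i.e. $U^*\mathcal{B}U\subseteq\mathcal{B}$.
   Context: $\mathcal{B}(\mathcal{H})$ is the algebra of bounded linear operators on $\mathcal{H}$. A set $\mathcal{A}\subseteq\mathcal{B}(\mathcal{H})$ is called self-adjoint if $A\in\mathcal{A}$ implies $A^*\in\mathcal{A}$. The subalgebra of compact operators of $\mathcal{A}$ is $\{A\in\mathcal{A}: A \text{ is compact}\}$. A masa is an abelian self-adjoint subalgebra of $\mathcal{B}(\mathcal{H})$ that is maximal (under inclusion) among abelian self-adjoint subalgebras. *)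

theory Defs
  imports "HOL-Analysis.Analysis"
begin

text \<open>
  Complex Hilbert spaces, as a class on top of the real Banach spaces of the library
  (which supplies the norm, the metric, the topology and completeness).
  The inner product is linear in its first argument.  Positive definiteness
  follows from the last axiom and the properties of the norm.
\<close>

class complex_hilbert_space = banach +
  fixes scaleC :: "complex \<Rightarrow> 'a \<Rightarrow> 'a"  (infixr \<open>*\<^sub>C\<close> 75)
    and cinner :: "'a \<Rightarrow> 'a \<Rightarrow> complex"
  assumes scaleC_add_right: "a *\<^sub>C (x + y) = a *\<^sub>C x + a *\<^sub>C y"
    and scaleC_add_left: "(a + b) *\<^sub>C x = a *\<^sub>C x + b *\<^sub>C x"
    and scaleC_scaleC: "a *\<^sub>C (b *\<^sub>C x) = (a * b) *\<^sub>C x"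
    and scaleC_one: "1 *\<^sub>C x = x"
    and scaleR_scaleC: "r *\<^sub>R x = complex_of_real r *\<^sub>C x"
    and cinner_add_left: "cinner (x + y) z = cinner x z + cinner y z"
    and cinner_scaleC_left: "cinner (a *\<^sub>C x) y = a * cinner x y"
    and cinner_commute: "cinner x y = cnj (cinner y x)"
    and cinner_self: "cinner x x = complex_of_real ((norm x)\<^sup>2)"

lemma vector_space_scaleC: "vector_space (scaleC :: complex \<Rightarrow> 'h \<Rightarrow> 'h::complex_hilbert_space)"
  by unfold_locales (simp_all add: scaleC_add_right scaleC_add_left scaleC_scaleC scaleC_one)

definition infinite_dimensional :: "'h::complex_hilbert_space itself \<Rightarrow> bool"
  where "infinite_dimensional _ \<longleftrightarrow>
    \<not> (\<exists>S :: 'h set. finite S \<and> module.span scaleC S = UNIV)"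


text \<open>Operators are plain functions; \<open>bounded_operators\<close> is the algebra B(H).\<close>

definition bounded_operators :: "('h::complex_hilbert_space \<Rightarrow> 'h) set"
  where "bounded_operators = {A. bounded_linear A \<and> (\<forall>c x. A (c *\<^sub>C x) = c *\<^sub>C A x)}"

text \<open>The adjoint is meaningful for bounded operators only, where it exists by Riesz representation.\<close>

definition cadjoint :: "('h::complex_hilbert_space \<Rightarrow> 'h) \<Rightarrow> 'h \<Rightarrow> 'h"
  where "cadjoint A =
    (THE B. B \<in> bounded_operators \<and> (\<forall>x y. cinner (A x) y = cinner x (B y)))"

definition unitary_operator :: "('h::complex_hilbert_space \<Rightarrow> 'h) \<Rightarrow> bool"
  where "unitary_operator U \<longleftrightarrow>
    U \<in> bounded_operators \<and> cadjoint U \<circ> U = id \<and> U \<circ> cadjoint U = id"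

definition compact_operator :: "('h::complex_hilbert_space \<Rightarrow> 'h) \<Rightarrow> bool"
  where "compact_operator A \<longleftrightarrow> A \<in> bounded_operators \<and> compact (closure (A ` cball 0 1))"

text \<open>
  The weak operator topology on B(H) is the initial topology of the maps sending \<open>T\<close> to
  \<open>cinner (T x) y\<close>: the euclidean topology on a function type is the topology of
  pointwise convergence.
\<close>

definition weak_operator_topology :: "('h::complex_hilbert_space \<Rightarrow> 'h) topology"
  where "weak_operator_topology =
    pullback_topology bounded_operators (\<lambda>T (x, y). cinner (T x) y) euclidean"


text \<open>Algebras are not required to contain the identity operator.\<close>

definition operator_algebra :: "('h::complex_hilbert_space \<Rightarrow> 'h) set \<Rightarrow> bool"
  where "operator_algebra \<A> \<longleftrightarrow>
    \<A> \<subseteq> bounded_operators \<and>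
    (\<lambda>x. 0) \<in> \<A> \<and>
    (\<forall>A\<in>\<A>. \<forall>B\<in>\<A>. (\<lambda>x. A x + B x) \<in> \<A>) \<and>
    (\<forall>c. \<forall>A\<in>\<A>. (\<lambda>x. c *\<^sub>C A x) \<in> \<A>) \<and>
    (\<forall>A\<in>\<A>. \<forall>B\<in>\<A>. A \<circ> B \<in> \<A>)"

definition abelian_selfadjoint_algebra :: "('h::complex_hilbert_space \<Rightarrow> 'h) set \<Rightarrow> bool"
  where "abelian_selfadjoint_algebra \<A> \<longleftrightarrow>
    operator_algebra \<A> \<and>
    (\<forall>A\<in>\<A>. \<forall>B\<in>\<A>. A \<circ> B = B \<circ> A) \<and>
    (\<forall>A\<in>\<A>. cadjoint A \<in> \<A>)"

definition masa :: "('h::complex_hilbert_space \<Rightarrow> 'h) set \<Rightarrow> bool"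
  where "masa \<B> \<longleftrightarrow>
    abelian_selfadjoint_algebra \<B> \<and>
    (\<forall>\<C>. abelian_selfadjoint_algebra \<C> \<and> \<B> \<subseteq> \<C> \<longrightarrow> \<C> = \<B>)"

definition conjugation_invariant ::
    "('h::complex_hilbert_space \<Rightarrow> 'h) \<Rightarrow> ('h \<Rightarrow> 'h) set \<Rightarrow> bool"
  where "conjugation_invariant U \<A> \<longleftrightarrow> (\<lambda>A. cadjoint U \<circ> A \<circ> U) ` \<A> \<subseteq> \<A>"

end

theory Submission
  imports Defs
begin

text \<open>
  Conjugation by \<open>U\<close> may map \<open>\<A>\<close> onto a proper subset of itself.  So \<open>\<A>\<close> is
  replaced by the set \<open>K\<close> of all hermitian compact operators that some iterate of the
  conjugation moves into \<open>\<A>\<close>.  This set is still commuting, it is invariant under the whole group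
  \<open>G\<close> of powers of \<open>U\<close>, and it contains the hermitian compact operators of \<open>\<A>\<close>.

  A commuting family of compact hermitian operators has a total set of pairwise orthogonal joint
  eigenspaces (\<open>joint_eigenspaces_total\<close>), and \<open>G\<close> permutes them.  This discreteness is what
  compactness contributes.  The operators of \<open>K\<close>, together with the pieces \<open>Z P\<close>, where \<open>P\<close>
  projects onto a joint eigenspace and \<open>Z\<close> in \<open>G\<close> maps this eigenspace onto itself, form
  a commuting, self-adjoint and \<open>G\<close>-invariant set.  By Zorn's lemma it lies in a maximal set \<open>M\<close> of this
  kind.

  The point is that \<open>M\<close> is maximal even without the requirement of invariance, that is, \<open>M\<close> is
  its own commutant.  For a hermitian \<open>T\<close> in the commutant and a joint eigenspace with
  projection \<open>P\<close>, the conjugates of \<open>T P\<close> under \<open>G\<close> commute with \<open>M\<close> and with each other: two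
  of them live on different, hence orthogonal, eigenspaces, or on the same one; in the second case they
  differ by conjugation with some \<open>Z\<close> that maps the eigenspace onto itself, and they are equal
  because \<open>Z P\<close> belongs to \<open>M\<close> and so commutes with \<open>T\<close>.  Hence \<open>T P\<close> can be adjoined, so it already lies in \<open>M\<close>
  (\<open>maximal_absorbs\<close>).  As the eigenspaces are total, \<open>T\<close> commutes with the
  commutant of \<open>M\<close>; the commutant is therefore itself a commuting invariant set, and equals
  \<open>M\<close> (\<open>invariant_masa_exists\<close>).

  Being a commutant, \<open>M\<close> is a weakly closed algebra.  It contains the compact operators of \<open>\<A>\<close>
  through their real and imaginary parts, and so it contains their weak closure \<open>\<A>\<close>.
\<close>

section \<open>Inner product geometry\<close>

lemma scaleC_zero_left [simp]: "0 *\<^sub>C (x::'h::complex_hilbert_space) = 0"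
  using scaleR_scaleC[of 0 x] by simp

lemma uminus_scaleC: "- (x::'h::complex_hilbert_space) = (-1) *\<^sub>C x"
  using scaleR_scaleC[of "-1" x] by simp

lemma scaleC_zero_right [simp]: "c *\<^sub>C (0::'h::complex_hilbert_space) = 0"
  using scaleC_add_right[of c 0 "0::'h"] by simp

lemma scaleC_minus_right [simp]: "c *\<^sub>C (- x) = - (c *\<^sub>C (x::'h::complex_hilbert_space))"
  unfolding uminus_scaleC scaleC_scaleC by simp

lemma scaleC_diff_right: "c *\<^sub>C (x - y) = c *\<^sub>C x - c *\<^sub>C (y::'h::complex_hilbert_space)"
  using scaleC_add_right[of c x "- y"] by simp

lemma cinner_zero_left [simp]: "cinner 0 (y::'h::complex_hilbert_space) = 0"
  using cinner_scaleC_left[of 0 0 y] by simp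

lemma cinner_zero_right [simp]: "cinner (y::'h::complex_hilbert_space) 0 = 0"
  by (subst cinner_commute) simp

lemma cinner_minus_left [simp]: "cinner (- x) (y::'h::complex_hilbert_space) = - cinner x y"
  unfolding uminus_scaleC[of x] cinner_scaleC_left by simp

lemma cinner_diff_left: "cinner (x - y) (z::'h::complex_hilbert_space) = cinner x z - cinner y z"
  using cinner_add_left[of x "- y" z] by simp

lemma cinner_scaleC_right: "cinner x (c *\<^sub>C y) = cnj c * cinner x (y::'h::complex_hilbert_space)"
  by (subst (1 2) cinner_commute) (simp add: cinner_scaleC_left)

lemma cinner_add_right:
  "cinner x (y + z) = cinner x y + cinner x (z::'h::complex_hilbert_space)"
  by (subst (1 2 3) cinner_commute) (simp add: cinner_add_left)

lemma cinner_minus_right [simp]: "cinner x (- y) = - cinner x (y::'h::complex_hilbert_space)"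
  by (subst (1 2) cinner_commute) simp

lemma cinner_diff_right:
  "cinner x (y - z) = cinner x y - cinner x (z::'h::complex_hilbert_space)"
  using cinner_add_right[of x y "- z"] by simp

lemma cinner_scaleR_left:
  "cinner (r *\<^sub>R x) y = of_real r * cinner x (y::'h::complex_hilbert_space)"
  by (simp add: scaleR_scaleC cinner_scaleC_left)

lemma cinner_scaleR_right:
  "cinner x (r *\<^sub>R y) = of_real r * cinner x (y::'h::complex_hilbert_space)"
  by (simp add: scaleR_scaleC cinner_scaleC_right)

lemmas cinner_simps = cinner_add_left cinner_add_right cinner_diff_left cinner_diff_right
  cinner_scaleC_left cinner_scaleC_right cinner_scaleR_left cinner_scaleR_right

lemma cinner_self_eq_0_iff [simp]: "cinner x x = 0 \<longleftrightarrow> x = (0::'h::complex_hilbert_space)"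
  by (simp add: cinner_self)

lemma cinner_ext:
  assumes "\<And>x. cinner x y = cinner x (z::'h::complex_hilbert_space)"
  shows "y = z"
  using assms[of "y - z"] cinner_self_eq_0_iff[of "y - z"] by (simp add: cinner_diff_right)

text \<open>Pythagoras for the component of \<open>x\<close> along \<open>y\<close>.  Nonnegativity of the left side is the
  Cauchy-Schwarz inequality; that the right side is less than the square of the norm of
  \<open>x\<close> unless \<open>x\<close> is orthogonal to \<open>y\<close> identifies nearest points.\<close>

lemma norm_diff_component:
  fixes x y :: "'h::complex_hilbert_space"
  assumes "y \<noteq> 0"
  shows "(norm (x - (cinner x y / of_real ((norm y)\<^sup>2)) *\<^sub>C y))\<^sup>2
    = (norm x)\<^sup>2 - (cmod (cinner x y))\<^sup>2 / (norm y)\<^sup>2"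
proof -
  define p q where "p = cinner x y" and "q = complex_of_real ((norm y)\<^sup>2)"
  have q: "q \<noteq> 0" "cnj q = q" "cinner y y = q" and yx: "cinner y x = cnj p"
    using assms by (auto simp: q_def p_def cinner_self cinner_commute[of y x])
  have "cinner (x - (p / q) *\<^sub>C y) (x - (p / q) *\<^sub>C y) = cinner x x - p * cnj p / q"
    using q yx by (simp add: cinner_simps p_def[symmetric] field_simps)
  also have "\<dots> = complex_of_real ((norm x)\<^sup>2 - (cmod p)\<^sup>2 / (norm y)\<^sup>2)"
    unfolding q_def cinner_self of_real_diff of_real_divide complex_norm_square[symmetric] by simp
  finally have "complex_of_real ((norm (x - (p / q) *\<^sub>C y))\<^sup>2)
      = complex_of_real ((norm x)\<^sup>2 - (cmod p)\<^sup>2 / (norm y)\<^sup>2)"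
    unfolding cinner_self .
  then show ?thesis
    unfolding p_def q_def of_real_eq_iff .
qed

lemma Cauchy_Schwarz_cinner:
  fixes x y :: "'h::complex_hilbert_space"
  shows "cmod (cinner x y) \<le> norm x * norm y"
proof (cases "y = 0")
  case False
  then have "(cmod (cinner x y))\<^sup>2 / (norm y)\<^sup>2 \<le> (norm x)\<^sup>2"
    using norm_diff_component[of y x] zero_le_power2 by (smt (verit))
  then have "(cmod (cinner x y))\<^sup>2 \<le> (norm x * norm y)\<^sup>2"
    using False by (simp add: field_simps power_mult_distrib)
  then show ?thesis
    by (rule power2_le_imp_le) simp
qed simp

lemma bounded_linear_cinner_left: "bounded_linear (\<lambda>x. cinner x (y::'h::complex_hilbert_space))"
  by (rule bounded_linear_intro[where K = "norm y"])
     (simp_all add: cinner_simps Cauchy_Schwarz_cinner scaleR_conv_of_real)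

lemma parallelogram_law:
  fixes x y :: "'h::complex_hilbert_space"
  shows "(norm (x + y))\<^sup>2 + (norm (x - y))\<^sup>2 = 2 * (norm x)\<^sup>2 + 2 * (norm y)\<^sup>2"
proof -
  have "complex_of_real ((norm (x + y))\<^sup>2 + (norm (x - y))\<^sup>2)
      = of_real (2 * (norm x)\<^sup>2 + 2 * (norm y)\<^sup>2)"
    by (simp add: cinner_self[symmetric] cinner_simps flip: of_real_power)
  then show ?thesis
    unfolding of_real_eq_iff .
qed

definition closed_csubspace :: "'h::complex_hilbert_space set \<Rightarrow> bool"
  where "closed_csubspace X \<longleftrightarrow>
    closed X \<and> 0 \<in> X \<and> (\<forall>x\<in>X. \<forall>y\<in>X. x + y \<in> X) \<and> (\<forall>c. \<forall>x\<in>X. c *\<^sub>C x \<in> X)"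

lemma closed_csubspaceD:
  assumes "closed_csubspace X"
  shows "closed X" "0 \<in> X" "x \<in> X \<Longrightarrow> y \<in> X \<Longrightarrow> x + y \<in> X" "x \<in> X \<Longrightarrow> c *\<^sub>C x \<in> X"
    "x \<in> X \<Longrightarrow> r *\<^sub>R x \<in> X" "x \<in> X \<Longrightarrow> y \<in> X \<Longrightarrow> x - y \<in> X"
proof -
  have *: "x \<in> X \<Longrightarrow> y \<in> X \<Longrightarrow> x + (-1) *\<^sub>C y \<in> X" for x y
    using assms unfolding closed_csubspace_def by blast
  show "x \<in> X \<Longrightarrow> y \<in> X \<Longrightarrow> x - y \<in> X"
    using *[of x y] by (simp add: uminus_scaleC[symmetric])
qed (use assms in \<open>auto simp: closed_csubspace_def scaleR_scaleC\<close>)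

text \<open>The parallelogram law makes every minimizing sequence a Cauchy sequence.\<close>

lemma nearest_point_exists:
  fixes X :: "'h::complex_hilbert_space set"
  assumes X: "closed_csubspace X"
  shows "\<exists>y\<in>X. \<forall>z\<in>X. norm (x - y) \<le> norm (x - z)"
proof -
  note XD = closed_csubspaceD[OF X]
  define d where "d = infdist x X"
  have ne: "X \<noteq> {}" using XD(2) by blast
  have d0: "0 \<le> d" by (simp add: d_def infdist_nonneg)
  have d_le: "d \<le> norm (x - z)" if "z \<in> X" for z
    using infdist_le[OF that, of x] by (simp add: d_def dist_norm)
  have "\<exists>z\<in>X. norm (x - z) < d + inverse (real (Suc n))" for n
  proof (rule ccontr)
    assume "\<not> ?thesis"
    then have "d + inverse (real (Suc n)) \<le> infdist x X"
      unfolding infdist_notempty[OF ne] using ne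
      by (intro cINF_greatest) (auto simp: dist_norm not_less)
    then show False by (simp add: d_def)
  qed
  then obtain y where yX: "\<And>n. y n \<in> X"
    and yd: "\<And>n. norm (x - y n) < d + inverse (real (Suc n))" by metis
  have lim: "(\<lambda>n. norm (x - y n)) \<longlonglongrightarrow> d"
  proof (rule tendsto_sandwich[of "\<lambda>_. d" _ _ "\<lambda>n. d + inverse (real (Suc n))"])
    show "(\<lambda>n. d + inverse (real (Suc n))) \<longlonglongrightarrow> d"
      using tendsto_add[OF tendsto_const[of d] LIMSEQ_inverse_real_of_nat] by simp
  qed (intro always_eventually allI d_le[OF yX] less_imp_le[OF yd] tendsto_const)+
  have gap: "(norm (y m - y n))\<^sup>2
      \<le> 2 * ((norm (x - y m))\<^sup>2 - d\<^sup>2) + 2 * ((norm (x - y n))\<^sup>2 - d\<^sup>2)" for m n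
  proof -
    \<comment> \<open>the midpoint of the two approximants lies in the subspace, so its distance is at least \<open>d\<close>\<close>
    have "(1/2) *\<^sub>R (y m + y n) \<in> X" by (intro XD(5) XD(3) yX)
    then have "d \<le> norm (x - (1/2) *\<^sub>R (y m + y n))" by (rule d_le)
    moreover have "(x - y m) + (x - y n) = 2 *\<^sub>R (x - (1/2) *\<^sub>R (y m + y n))"
      by (simp add: scaleR_right_diff_distrib scaleR_2)
    ultimately have "2 * d \<le> norm ((x - y m) + (x - y n))" by simp
    then have "(2 * d)\<^sup>2 \<le> (norm ((x - y m) + (x - y n)))\<^sup>2"
      using d0 by (intro power_mono) auto
    then show ?thesis
      using parallelogram_law[of "x - y m" "x - y n"]
      by (simp add: power_mult_distrib norm_minus_commute)
  qed
  have "Cauchy y"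
  proof (rule metric_CauchyI)
    fix e :: real assume e: "0 < e"
    have "(\<lambda>n. (norm (x - y n))\<^sup>2 - d\<^sup>2) \<longlonglongrightarrow> d\<^sup>2 - d\<^sup>2"
      by (intro tendsto_intros lim)
    then have "\<forall>\<^sub>F n in sequentially. (norm (x - y n))\<^sup>2 - d\<^sup>2 < e\<^sup>2 / 4"
      using e by (intro order_tendstoD) auto
    then obtain N where N: "\<And>n. n \<ge> N \<Longrightarrow> (norm (x - y n))\<^sup>2 - d\<^sup>2 < e\<^sup>2 / 4"
      by (auto simp: eventually_sequentially)
    have "dist (y m) (y n) < e" if "m \<ge> N" "n \<ge> N" for m n
    proof -
      have "(norm (y m - y n))\<^sup>2 < e\<^sup>2"
        by (rule order.strict_trans1[OF gap]) (use N[OF that(1)] N[OF that(2)] in argo)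
      then show ?thesis using e power2_less_imp_less[of "norm (y m - y n)" e] by (simp add: dist_norm)
    qed
    then show "\<exists>M. \<forall>m\<ge>M. \<forall>n\<ge>M. dist (y m) (y n) < e" by blast
  qed
  then obtain l where l: "y \<longlonglongrightarrow> l" using Cauchy_convergent convergent_def by blast
  have "l \<in> X" using closed_sequentially[OF XD(1) _ l] yX by blast
  moreover have "norm (x - l) = d"
    using LIMSEQ_unique[OF lim tendsto_norm[OF tendsto_diff[OF tendsto_const l]]] by simp
  ultimately show ?thesis using d_le by auto
qed

text \<open>Were \<open>x - y\<close> not orthogonal to some \<open>z\<close>, subtracting its component along \<open>z\<close> would give
  a point of the subspace strictly nearer to \<open>x\<close>.\<close>

lemma orthogonal_decomposition:
  fixes X :: "'h::complex_hilbert_space set"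
  assumes X: "closed_csubspace X"
  shows "\<exists>y\<in>X. \<forall>z\<in>X. cinner (x - y) z = 0"
proof -
  obtain y where y: "y \<in> X" and min: "\<And>z. z \<in> X \<Longrightarrow> norm (x - y) \<le> norm (x - z)"
    using nearest_point_exists[OF X] by blast
  have "cinner (x - y) z = 0" if z: "z \<in> X" for z
  proof (cases "z = 0")
    case False
    define a where "a = cinner (x - y) z / of_real ((norm z)\<^sup>2)"
    have "y + a *\<^sub>C z \<in> X" by (intro closed_csubspaceD[OF X] y z)
    then have "norm (x - y) \<le> norm (x - y - a *\<^sub>C z)" using min by (simp add: diff_diff_eq)
    then have "(norm (x - y))\<^sup>2 \<le> (norm (x - y - a *\<^sub>C z))\<^sup>2" by (intro power_mono) auto
    then have "(cmod (cinner (x - y) z))\<^sup>2 / (norm z)\<^sup>2 \<le> 0"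
      unfolding a_def norm_diff_component[OF False] by simp
    then show ?thesis using False by (simp add: field_simps)
  qed simp
  then show ?thesis using y by blast
qed

text \<open>A nonzero functional is determined by its value at one vector \<open>v\<close> orthogonal to its kernel,
  so a multiple of \<open>v\<close> represents it.\<close>

lemma Riesz_representation:
  fixes f :: "'h::complex_hilbert_space \<Rightarrow> complex"
  assumes f: "bounded_linear f" and fC: "\<And>c x. f (c *\<^sub>C x) = c * f x"
  shows "\<exists>z. \<forall>x. f x = cinner x z"
proof (cases "\<exists>u. f u \<noteq> 0")
  case True
  then obtain u where u: "f u \<noteq> 0" by blast
  interpret f: bounded_linear f by fact
  define N where "N = {x. f x = 0}"
  have N: "closed_csubspace N"
    unfolding closed_csubspace_def N_def
    by (auto simp: f.add fC f.zero intro!: closed_Collect_eq f.continuous_on continuous_intros)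
  obtain w where w: "w \<in> N" "\<And>n. n \<in> N \<Longrightarrow> cinner (u - w) n = 0"
    using orthogonal_decomposition[OF N, of u] by blast
  define v where "v = u - w"
  have fv: "f v \<noteq> 0" using u w by (simp add: v_def f.diff N_def)
  then have v0: "v \<noteq> 0" using f.zero by auto
  have "f x = cinner x ((cnj (f v) / of_real ((norm v)\<^sup>2)) *\<^sub>C v)" for x
  proof -
    have "x - (f x / f v) *\<^sub>C v \<in> N" using fv by (simp add: N_def f.diff fC)
    then have "cinner v (x - (f x / f v) *\<^sub>C v) = 0" using w v_def by blast
    then have "cinner (x - (f x / f v) *\<^sub>C v) v = 0"
      by (subst cinner_commute) simp
    then have "cinner x v = f x / f v * of_real ((norm v)\<^sup>2)"
      by (simp add: cinner_simps cinner_self)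
    then show ?thesis using fv v0 by (simp add: cinner_simps)
  qed
  then show ?thesis by blast
qed (auto intro: exI[of _ 0])

section \<open>Bounded operators and their adjoints\<close>

lemma bounded_operatorsI:
  fixes A :: "'h::complex_hilbert_space \<Rightarrow> 'h"
  assumes "\<And>x y. A (x + y) = A x + A y" "\<And>c x. A (c *\<^sub>C x) = c *\<^sub>C A x"
    and "\<And>x. norm (A x) \<le> norm x * k"
  shows "A \<in> bounded_operators"
  unfolding bounded_operators_def using assms
  by (auto intro!: bounded_linear_intro[where K = k] simp: scaleR_scaleC)

lemma bounded_operatorsD:
  assumes "A \<in> bounded_operators"
  shows "bounded_linear A" "A (x + y) = A x + A y" "A (c *\<^sub>C x) = c *\<^sub>C A x"
    "A (x - y) = A x - A y" "A (r *\<^sub>R x) = r *\<^sub>R A x" "A 0 = 0"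
proof -
  show A: "bounded_linear A" and "A (c *\<^sub>C x) = c *\<^sub>C A x"
    using assms by (auto simp: bounded_operators_def)
  then show "A (x + y) = A x + A y" "A (x - y) = A x - A y" "A (r *\<^sub>R x) = r *\<^sub>R A x" "A 0 = 0"
    using bounded_linear.linear[OF A] by (auto simp: linear_add linear_diff linear_scale linear_0)
qed

lemma bounded_operators_add:
  "A \<in> bounded_operators \<Longrightarrow> B \<in> bounded_operators \<Longrightarrow> (\<lambda>x. A x + B x) \<in> bounded_operators"
  unfolding bounded_operators_def by (auto intro: bounded_linear_add simp: scaleC_add_right)

lemma bounded_operators_comp:
  "A \<in> bounded_operators \<Longrightarrow> B \<in> bounded_operators \<Longrightarrow> A \<circ> B \<in> bounded_operators"
  unfolding bounded_operators_def by (auto intro: bounded_linear_compose simp: comp_def)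

lemma bounded_operators_zero: "(\<lambda>x. 0) \<in> bounded_operators"
  by (rule bounded_operatorsI[where k = 0]) auto

lemma bounded_operators_id: "id \<in> bounded_operators"
  by (rule bounded_operatorsI[where k = 1]) auto

lemma norm_scaleC: "norm (c *\<^sub>C x) = cmod c * norm (x::'h::complex_hilbert_space)"
proof -
  have "cinner (c *\<^sub>C x) (c *\<^sub>C x) = c * cnj c * cinner x x"
    by (simp add: cinner_simps)
  then have "complex_of_real ((norm (c *\<^sub>C x))\<^sup>2) = of_real ((cmod c * norm x)\<^sup>2)"
    unfolding cinner_self complex_norm_square[symmetric] by (simp add: power_mult_distrib)
  then show ?thesis unfolding of_real_eq_iff by (simp add: power2_eq_iff_nonneg)
qed

lemma bounded_operators_scaleC:
  assumes "A \<in> bounded_operators"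
  shows "(\<lambda>x. c *\<^sub>C A x) \<in> bounded_operators"
proof -
  obtain k where k: "\<And>x. norm (A x) \<le> norm x * k"
    using bounded_linear.bounded[OF bounded_operatorsD(1)[OF assms]] by blast
  show ?thesis
  proof (rule bounded_operatorsI[where k = "cmod c * k"])
    show "norm (c *\<^sub>C A x) \<le> norm x * (cmod c * k)" for x
      using mult_left_mono[OF k[of x], of "cmod c"] by (simp add: norm_scaleC mult_ac)
  qed (simp_all add: bounded_operatorsD[OF assms] scaleC_add_right scaleC_scaleC mult.commute)
qed

lemma cadjoint_eqI:
  assumes "B \<in> bounded_operators" "\<And>x y. cinner (A x) y = cinner x (B y)"
  shows "cadjoint A = B"
  unfolding cadjoint_def
proof (rule the_equality)
  fix C assume "C \<in> bounded_operators \<and> (\<forall>x y. cinner (A x) y = cinner x (C y))"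
  then have "cinner x (C y) = cinner x (B y)" for x y using assms(2)[of x y] by metis
  then show "C = B" using cinner_ext by blast
qed (use assms in auto)

lemma adjoint_exists:
  fixes A :: "'h::complex_hilbert_space \<Rightarrow> 'h"
  assumes A: "A \<in> bounded_operators"
  shows "\<exists>B\<in>bounded_operators. \<forall>x y. cinner (A x) y = cinner x (B y)"
proof -
  note AD = bounded_operatorsD[OF A]
  have "\<exists>z. \<forall>x. cinner (A x) y = cinner x z" for y
    by (rule Riesz_representation)
       (auto simp: AD cinner_scaleC_left intro: bounded_linear_compose[OF bounded_linear_cinner_left AD(1)])
  then obtain B where B: "\<And>x y. cinner (A x) y = cinner x (B y)" by metis
  obtain k where k: "\<And>x. norm (A x) \<le> norm x * k" and k0: "0 < k"
    using bounded_linear.pos_bounded[OF AD(1)] by blast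
  have "B \<in> bounded_operators"
  proof (rule bounded_operatorsI[where k = k])
    show "B (x + y) = B x + B y" for x y
      by (rule cinner_ext) (simp add: cinner_simps B[symmetric])
    show "B (c *\<^sub>C x) = c *\<^sub>C B x" for c x
      by (rule cinner_ext) (simp add: cinner_simps B[symmetric])
    fix y
    have "(norm (B y))\<^sup>2 = cmod (cinner (A (B y)) y)"
      by (simp add: B cinner_self norm_power)
    also have "\<dots> \<le> norm (A (B y)) * norm y" by (rule Cauchy_Schwarz_cinner)
    also have "\<dots> \<le> norm (B y) * k * norm y" by (intro mult_right_mono k) auto
    finally have "norm (B y) * norm (B y) \<le> norm (B y) * (norm y * k)"
      by (simp add: power2_eq_square mult_ac)
    then show "norm (B y) \<le> norm y * k"
      using k0 by (cases "B y = 0") auto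
  qed
  then show ?thesis using B by blast
qed

lemma
  assumes "A \<in> bounded_operators"
  shows cadjoint_bounded: "cadjoint A \<in> bounded_operators"
    and cinner_cadjoint_right: "cinner x (cadjoint A y) = cinner (A x) y"
proof -
  obtain B where B: "B \<in> bounded_operators" "\<And>x y. cinner (A x) y = cinner x (B y)"
    using adjoint_exists[OF assms] by blast
  then have "cadjoint A = B" by (rule cadjoint_eqI)
  with B show "cadjoint A \<in> bounded_operators" "cinner x (cadjoint A y) = cinner (A x) y"
    by simp_all
qed

lemma cinner_cadjoint_left:
  assumes A: "A \<in> bounded_operators"
  shows "cinner (cadjoint A x) y = cinner x (A y)"
proof -
  have "cinner (cadjoint A x) y = cnj (cinner y (cadjoint A x))" by (rule cinner_commute)
  also have "\<dots> = cnj (cinner (A y) x)" by (simp only: cinner_cadjoint_right[OF A])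
  also have "\<dots> = cinner x (A y)" by (rule cinner_commute[symmetric])
  finally show ?thesis .
qed

lemma cadjoint_cadjoint: "A \<in> bounded_operators \<Longrightarrow> cadjoint (cadjoint A) = A"
  by (rule cadjoint_eqI) (auto simp: cinner_cadjoint_left)

lemma cadjoint_comp:
  "A \<in> bounded_operators \<Longrightarrow> B \<in> bounded_operators \<Longrightarrow>
    cadjoint (A \<circ> B) = cadjoint B \<circ> cadjoint A"
  by (rule cadjoint_eqI) (auto simp: cinner_cadjoint_right bounded_operators_comp cadjoint_bounded)

lemma cadjoint_id: "cadjoint id = id"
  by (rule cadjoint_eqI) (auto simp: bounded_operators_id)

lemma cadjoint_add:
  "A \<in> bounded_operators \<Longrightarrow> B \<in> bounded_operators \<Longrightarrow>
    cadjoint (\<lambda>x. A x + B x) = (\<lambda>x. cadjoint A x + cadjoint B x)"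
  by (rule cadjoint_eqI) (auto simp: cinner_cadjoint_right bounded_operators_add cadjoint_bounded cinner_simps)

lemma cadjoint_scaleC:
  "A \<in> bounded_operators \<Longrightarrow> cadjoint (\<lambda>x. c *\<^sub>C A x) = (\<lambda>x. cnj c *\<^sub>C cadjoint A x)"
  by (rule cadjoint_eqI) (auto simp: cinner_cadjoint_right bounded_operators_scaleC cadjoint_bounded cinner_simps)

lemma unitary_operatorD:
  assumes "unitary_operator V"
  shows "V \<in> bounded_operators" "cadjoint V (V x) = x" "V (cadjoint V x) = x"
    "cinner (V x) (V y) = cinner x y" "norm (V x) = norm x"
proof -
  show V: "V \<in> bounded_operators" using assms by (simp add: unitary_operator_def)
  show *: "cadjoint V (V x) = x" for x
    using assms unfolding unitary_operator_def by (metis comp_apply id_apply)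
  show "V (cadjoint V x) = x"
    using assms unfolding unitary_operator_def by (metis comp_apply id_apply)
  show **: "cinner (V x) (V y) = cinner x y" for y
    using cinner_cadjoint_right[OF V, of x "V y"] by (simp add: *)
  have "complex_of_real ((norm (V x))\<^sup>2) = of_real ((norm x)\<^sup>2)"
    unfolding cinner_self[symmetric] by (rule **)
  then show "norm (V x) = norm x"
    unfolding of_real_eq_iff by (simp add: power2_eq_iff_nonneg)
qed

lemma unitary_operator_cadjoint: "unitary_operator V \<Longrightarrow> unitary_operator (cadjoint V)"
  unfolding unitary_operator_def by (simp add: cadjoint_cadjoint cadjoint_bounded)

lemma unitary_operator_id: "unitary_operator id"
  unfolding unitary_operator_def by (simp add: cadjoint_id bounded_operators_id)

lemma unitary_operator_comp:
  assumes "unitary_operator V" "unitary_operator W"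
  shows "unitary_operator (V \<circ> W)"
  unfolding unitary_operator_def
  using unitary_operatorD[OF assms(1)] unitary_operatorD[OF assms(2)]
  by (auto simp: cadjoint_comp bounded_operators_comp fun_eq_iff)

section \<open>Orthogonal projections\<close>

text \<open>The choice is unique, and a point to choose exists, when \<open>X\<close> is a closed subspace; the value
  is arbitrary for other sets.\<close>

definition orthogonal_projection :: "'h::complex_hilbert_space set \<Rightarrow> 'h \<Rightarrow> 'h"
  where "orthogonal_projection X x = (SOME y. y \<in> X \<and> (\<forall>z\<in>X. cinner (x - y) z = 0))"

lemma
  assumes "closed_csubspace X"
  shows orthogonal_projection_in: "orthogonal_projection X x \<in> X"
    and orthogonal_projection_perp: "z \<in> X \<Longrightarrow> cinner (x - orthogonal_projection X x) z = 0"
proof -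
  have "\<exists>y. y \<in> X \<and> (\<forall>z\<in>X. cinner (x - y) z = 0)"
    using orthogonal_decomposition[OF assms] by blast
  from someI_ex[OF this] show "orthogonal_projection X x \<in> X"
    "z \<in> X \<Longrightarrow> cinner (x - orthogonal_projection X x) z = 0"
    unfolding orthogonal_projection_def by blast+
qed

lemma orthogonal_projection_eqI:
  assumes X: "closed_csubspace X" and y: "y \<in> X" "\<And>z. z \<in> X \<Longrightarrow> cinner (x - y) z = 0"
  shows "orthogonal_projection X x = y"
proof -
  let ?p = "orthogonal_projection X x"
  have d: "?p - y \<in> X"
    by (intro closed_csubspaceD[OF X] y orthogonal_projection_in[OF X])
  have "cinner (x - y) (?p - y) - cinner (x - ?p) (?p - y) = 0"
    using y(2)[OF d] orthogonal_projection_perp[OF X d] by simp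
  then have "cinner (?p - y) (?p - y) = 0"
    by (simp add: cinner_diff_left)
  then show ?thesis by simp
qed

lemma orthogonal_projection_fixes:
  "closed_csubspace X \<Longrightarrow> x \<in> X \<Longrightarrow> orthogonal_projection X x = x"
  by (rule orthogonal_projection_eqI) auto

lemma orthogonal_projection_kills:
  "closed_csubspace X \<Longrightarrow> (\<And>z. z \<in> X \<Longrightarrow> cinner x z = 0) \<Longrightarrow> orthogonal_projection X x = 0"
  by (rule orthogonal_projection_eqI) (auto simp: closed_csubspaceD)

lemma orthogonal_projection_bounded:
  assumes X: "closed_csubspace X"
  shows "orthogonal_projection X \<in> bounded_operators"
proof (rule bounded_operatorsI[where k = 1])
  let ?P = "orthogonal_projection X"
  note in_X = orthogonal_projection_in[OF X] and perp = orthogonal_projection_perp[OF X]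
  show "?P (x + y) = ?P x + ?P y" for x y
  proof (rule orthogonal_projection_eqI[OF X])
    show "?P x + ?P y \<in> X" by (intro closed_csubspaceD[OF X] in_X)
    have "x + y - (?P x + ?P y) = (x - ?P x) + (y - ?P y)" by simp
    then show "cinner (x + y - (?P x + ?P y)) z = 0" if "z \<in> X" for z
      by (simp only: cinner_add_left perp[OF that] add_0)
  qed
  show "?P (c *\<^sub>C x) = c *\<^sub>C ?P x" for c x
  proof (rule orthogonal_projection_eqI[OF X])
    show "c *\<^sub>C ?P x \<in> X" by (intro closed_csubspaceD[OF X] in_X)
    show "cinner (c *\<^sub>C x - c *\<^sub>C ?P x) z = 0" if "z \<in> X" for z
      by (simp only: scaleC_diff_right[symmetric] cinner_scaleC_left perp[OF that] mult_zero_right)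
  qed
  fix x
  have *: "cinner x (?P x) = cinner (?P x) (?P x)"
    using perp[OF in_X, of x x] by (simp add: cinner_diff_left)
  then have "(norm (?P x))\<^sup>2 = cmod (cinner x (?P x))"
    by (simp only: * cinner_self norm_of_real abs_power2)
  then have "norm (?P x) * norm (?P x) \<le> norm x * norm (?P x)"
    using Cauchy_Schwarz_cinner[of x "?P x"] by (simp add: power2_eq_square)
  then show "norm (?P x) \<le> norm x * 1"
    by (cases "?P x = 0") auto
qed

lemma cadjoint_orthogonal_projection:
  assumes X: "closed_csubspace X"
  shows "cadjoint (orthogonal_projection X) = orthogonal_projection X"
proof (rule cadjoint_eqI[OF orthogonal_projection_bounded[OF X]])
  fix x y
  let ?P = "orthogonal_projection X"
  note perp = orthogonal_projection_perp[OF X orthogonal_projection_in[OF X]]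
  have "cinner (?P x) (y - ?P y) = 0"
    by (subst cinner_commute) (simp only: perp complex_cnj_zero)
  then show "cinner (?P x) y = cinner x (?P y)"
    using perp[of x y] by (simp add: cinner_diff_left cinner_diff_right)
qed

text \<open>Invariance of \<open>X\<close> under the adjoint makes \<open>T\<close> map the orthogonal complement of \<open>X\<close> into
  itself.\<close>

lemma orthogonal_projection_reducing:
  assumes X: "closed_csubspace X" and T: "T \<in> bounded_operators"
    and inv: "\<And>x. x \<in> X \<Longrightarrow> T x \<in> X" "\<And>x. x \<in> X \<Longrightarrow> cadjoint T x \<in> X"
  shows "orthogonal_projection X (T x) = T (orthogonal_projection X x)"
proof (rule orthogonal_projection_eqI[OF X])
  let ?P = "orthogonal_projection X"
  show "T (?P x) \<in> X" by (intro inv orthogonal_projection_in[OF X])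
  show "cinner (T x - T (?P x)) z = 0" if "z \<in> X" for z
    using orthogonal_projection_perp[OF X inv(2)[OF that]]
    by (simp only: bounded_operatorsD(4)[OF T, symmetric] cinner_cadjoint_right[OF T])
qed

lemma closed_csubspace_unitary_image:
  assumes X: "closed_csubspace X" and V: "unitary_operator V"
  shows "closed_csubspace (V ` X)"
proof -
  note VD = unitary_operatorD[OF V]
  have V': "cadjoint V \<in> bounded_operators" by (rule cadjoint_bounded[OF VD(1)])
  have eq: "V ` X = cadjoint V -` X"
  proof (intro set_eqI iffI)
    fix y assume "y \<in> cadjoint V -` X"
    then have "V (cadjoint V y) \<in> V ` X" by blast
    then show "y \<in> V ` X" by (simp only: VD(3))
  qed (auto simp: VD(2))
  have "closed (cadjoint V -` X)"
    using closed_csubspaceD(1)[OF X]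
      linear_continuous_on[OF bounded_operatorsD(1)[OF V'], of UNIV]
    by (intro closed_vimage) auto
  then show ?thesis
    unfolding closed_csubspace_def eq
    using closed_csubspaceD[OF X] bounded_operatorsD[OF V'] by auto
qed

lemma orthogonal_projection_unitary:
  assumes X: "closed_csubspace X" and V: "unitary_operator V"
  shows "orthogonal_projection (V ` X) (V x) = V (orthogonal_projection X x)"
proof (rule orthogonal_projection_eqI[OF closed_csubspace_unitary_image[OF X V]])
  let ?P = "orthogonal_projection X"
  note VD = unitary_operatorD[OF V]
  show "V (?P x) \<in> V ` X" by (intro imageI orthogonal_projection_in[OF X])
  fix z assume "z \<in> V ` X"
  then obtain w where w: "w \<in> X" "z = V w" by blast
  show "cinner (V x - V (?P x)) z = 0"
    unfolding w bounded_operatorsD(4)[OF VD(1), symmetric] VD(4)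
    by (rule orthogonal_projection_perp[OF X w(1)])
qed

section \<open>Commutants\<close>

definition commutant :: "('h::complex_hilbert_space \<Rightarrow> 'h) set \<Rightarrow> ('h \<Rightarrow> 'h) set"
  where "commutant S = {T \<in> bounded_operators. \<forall>A\<in>S. \<forall>x. T (A x) = A (T x)}"

lemma commutantI:
  "T \<in> bounded_operators \<Longrightarrow> (\<And>A x. A \<in> S \<Longrightarrow> T (A x) = A (T x)) \<Longrightarrow> T \<in> commutant S"
  by (simp add: commutant_def)

lemma commutantD:
  assumes "T \<in> commutant S"
  shows "T \<in> bounded_operators" "A \<in> S \<Longrightarrow> T (A x) = A (T x)"
  using assms by (auto simp: commutant_def)

lemma operator_algebra_commutant:
  assumes "S \<subseteq> bounded_operators"
  shows "operator_algebra (commutant S)"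
proof -
  have SD: "A (x + y) = A x + A y" "A (c *\<^sub>C x) = c *\<^sub>C A x" "A 0 = 0"
    if "A \<in> S" for A x y c
    using bounded_operatorsD[of A] assms that by auto
  show ?thesis
    unfolding operator_algebra_def commutant_def
    by (auto simp: SD bounded_operators_zero bounded_operators_add bounded_operators_scaleC
        bounded_operators_comp)
qed

lemma cadjoint_in_commutant:
  assumes S: "S \<subseteq> bounded_operators" "\<And>A. A \<in> S \<Longrightarrow> cadjoint A \<in> S" and T: "T \<in> commutant S"
  shows "cadjoint T \<in> commutant S"
proof (rule commutantI)
  note T' = commutantD[OF T]
  show "cadjoint T \<in> bounded_operators" by (rule cadjoint_bounded[OF T'(1)])
  fix A x assume A: "A \<in> S"
  then have A': "A \<in> bounded_operators" using S by blast
  have "T \<circ> cadjoint A = cadjoint A \<circ> T"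
    using T'(2)[OF S(2)[OF A]] by (simp add: fun_eq_iff)
  then have "cadjoint (T \<circ> cadjoint A) = cadjoint (cadjoint A \<circ> T)" by simp
  then show "cadjoint T (A x) = A (cadjoint T x)"
    by (simp add: cadjoint_comp cadjoint_bounded A' T'(1) cadjoint_cadjoint fun_eq_iff)
qed

lemma conjugate_in_commutant:
  assumes V: "unitary_operator V" and S: "\<And>A. A \<in> S \<Longrightarrow> V \<circ> A \<circ> cadjoint V \<in> S"
    and T: "T \<in> commutant S"
  shows "cadjoint V \<circ> T \<circ> V \<in> commutant S"
proof (rule commutantI)
  note VD = unitary_operatorD[OF V]
  show "cadjoint V \<circ> T \<circ> V \<in> bounded_operators"
    by (intro bounded_operators_comp cadjoint_bounded VD commutantD(1)[OF T])
  fix A x assume "A \<in> S"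
  from commutantD(2)[OF T S[OF this], of "V x"]
  have "T (V (A x)) = V (A (cadjoint V (T (V x))))" by (simp add: VD)
  then show "(cadjoint V \<circ> T \<circ> V) (A x) = A ((cadjoint V \<circ> T \<circ> V) x)" by (simp add: VD)
qed

text \<open>Commuting with \<open>A\<close> means \<open>cinner (T (A x)) y = cinner (T x) (cadjoint A y)\<close> for all
  \<open>x\<close> and \<open>y\<close>, and both sides are weakly continuous in \<open>T\<close>.\<close>

lemma commutant_weakly_closed:
  fixes S :: "('h::complex_hilbert_space \<Rightarrow> 'h) set"
  assumes S: "S \<subseteq> bounded_operators"
  shows "closedin weak_operator_topology (commutant S)"
proof -
  let ?F = "\<lambda>(T::'h \<Rightarrow> 'h) (x, y). cinner (T x) y"
  define C where "C = (\<Inter>A\<in>S. {g :: 'h \<times> 'h \<Rightarrow> complex.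
    \<forall>x y. g (A x, y) = g (x, cadjoint A y)})"
  have "closed C"
    unfolding C_def
    by (intro closed_INT ballI closed_Collect_all closed_Collect_eq
        continuous_on_product_coordinates)
  moreover have "commutant S = ?F -` C \<inter> bounded_operators"
  proof -
    have "(\<forall>x. T (A x) = A (T x)) \<longleftrightarrow> (\<forall>x y. cinner (T (A x)) y = cinner (T x) (cadjoint A y))"
      if "A \<in> S" for A T
    proof
      assume R: "\<forall>x y. cinner (T (A x)) y = cinner (T x) (cadjoint A y)"
      have A: "A \<in> bounded_operators" using S that by blast
      have "cinner (T (A x) - A (T x)) y = 0" for x y
        using R by (simp add: cinner_diff_left cinner_cadjoint_right[OF A])
      then show "\<forall>x. T (A x) = A (T x)"
        by (metis cinner_self_eq_0_iff eq_iff_diff_eq_0)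
    qed (use S that in \<open>auto simp: cinner_cadjoint_right\<close>)
    then show ?thesis unfolding commutant_def C_def by auto
  qed
  ultimately show ?thesis
    unfolding weak_operator_topology_def closedin_def topspace_pullback_topology
      openin_pullback_topology
    by (auto intro!: exI[of _ "- C"] simp: open_openin[symmetric] open_Compl)
qed

section \<open>Commuting compact hermitian operators\<close>

definition hermitian :: "('h::complex_hilbert_space \<Rightarrow> 'h) \<Rightarrow> bool"
  where "hermitian T \<longleftrightarrow> T \<in> bounded_operators \<and> cadjoint T = T"

lemma hermitianD:
  assumes "hermitian T"
  shows "T \<in> bounded_operators" "cadjoint T = T" "cinner (T x) y = cinner x (T y)"
  using assms cinner_cadjoint_right[of T x y] by (auto simp: hermitian_def)

text \<open>Compactness in sequential form passes to adjoints of normal operators, sums and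
  conjugates by arguments about a single subsequence.\<close>

definition compact_on_sequences :: "('h::complex_hilbert_space \<Rightarrow> 'h) \<Rightarrow> bool"
  where "compact_on_sequences T \<longleftrightarrow>
    (\<forall>x. (\<forall>n::nat. norm (x n) \<le> 1) \<longrightarrow> (\<exists>r. strict_mono r \<and> convergent (\<lambda>n. T (x (r n)))))"

lemma compact_on_sequencesE:
  assumes "compact_on_sequences T" "\<And>n::nat. norm (x n) \<le> 1"
  obtains r l where "strict_mono r" "(\<lambda>n. T (x (r n))) \<longlonglongrightarrow> l"
  using assms unfolding compact_on_sequences_def convergent_def by blast

lemma compact_operator_imp_sequences:
  assumes "compact_operator T"
  shows "compact_on_sequences T"
  unfolding compact_on_sequences_def
proof (intro allI impI)
  fix x :: "nat \<Rightarrow> 'a" assume x: "\<forall>n. norm (x n) \<le> 1"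
  have "compact (closure (T ` cball 0 1))"
    using assms by (simp add: compact_operator_def)
  moreover have "\<forall>n. T (x n) \<in> closure (T ` cball 0 1)"
    using x closure_subset by fastforce
  ultimately obtain l r where "strict_mono r" "((\<lambda>n. T (x n)) \<circ> r) \<longlonglongrightarrow> l"
    unfolding compact_def by meson
  then show "\<exists>r. strict_mono r \<and> convergent (\<lambda>n. T (x (r n)))"
    by (auto simp: convergent_def comp_def)
qed

lemma norm_diff_square:
  fixes x y :: "'h::complex_hilbert_space"
  shows "(norm (x - y))\<^sup>2 = (norm x)\<^sup>2 - 2 * Re (cinner x y) + (norm y)\<^sup>2"
proof -
  have sq: "(norm z)\<^sup>2 = Re (cinner z z)" for z :: 'h
    by (simp add: cinner_self del: of_real_power)
  have "Re (cinner y x) = Re (cinner x y)"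
    by (subst cinner_commute) simp
  then show ?thesis
    unfolding sq by (simp add: cinner_diff_left cinner_diff_right)
qed

text \<open>Along unit vectors of \<open>W\<close> on which \<open>norm \<circ> T\<close> tends to its supremum \<open>m\<close>,
  the vectors \<open>T (T x) - m\<^sup>2 x\<close> tend to zero; compactness produces a limit \<open>x\<close> with
  \<open>T (T x) = m\<^sup>2 x\<close>, and factoring \<open>T\<^sup>2 - m\<^sup>2\<close> gives an eigenvector for \<open>m\<close> or for \<open>-m\<close>.\<close>

lemma compact_hermitian_eigenvector:
  fixes T :: "'h::complex_hilbert_space \<Rightarrow> 'h"
  assumes T: "hermitian T" "compact_on_sequences T"
    and W: "closed W" "subspace W" "\<And>x. x \<in> W \<Longrightarrow> T x \<in> W"
    and w: "w \<in> W" "T w \<noteq> 0"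
  obtains c x where "c \<noteq> 0" "x \<in> W" "norm x = 1" "T x = c *\<^sub>R x"
proof -
  note TD = hermitianD[OF T(1)] and Tb = bounded_operatorsD[OF hermitianD(1)[OF T(1)]]
  define S where "S = {x \<in> W. norm x = 1}"
  define m where "m = (SUP x\<in>S. norm (T x))"
  obtain k where k: "\<And>x. norm (T x) \<le> norm x * k"
    using bounded_linear.bounded[OF Tb(1)] by blast
  have bdd: "bdd_above ((\<lambda>x. norm (T x)) ` S)"
  proof (rule bdd_aboveI2)
    show "norm (T x) \<le> k" if "x \<in> S" for x
      using k[of x] that by (simp add: S_def)
  qed
  have unit: "(1 / norm x) *\<^sub>R x \<in> S" if "x \<in> W" "x \<noteq> 0" for x
    using that W(2) by (simp add: S_def subspace_scale)
  have w0: "w \<noteq> 0" using w Tb(6) by metis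
  have m_ge: "norm (T x) \<le> m" if "x \<in> S" for x
    unfolding m_def by (rule cSUP_upper[OF that bdd])
  have m_bound: "norm (T x) \<le> m * norm x" if "x \<in> W" for x
  proof (cases "x = 0")
    case False
    then show ?thesis using m_ge[OF unit[OF that False]] by (simp add: Tb(5) field_simps)
  qed (simp add: Tb(6))
  have m0: "0 < m"
  proof (rule ccontr)
    assume "\<not> 0 < m"
    then have "m * norm w \<le> 0" by (simp add: mult_nonpos_nonneg)
    from order.trans[OF m_bound[OF w(1)] this] show False using w(2) by simp
  qed
  have "\<exists>x\<in>S. m - inverse (real (Suc n)) < norm (T x)" for n
    using less_cSUP_iff[OF _ bdd, of "m - inverse (real (Suc n))"] unit[OF w(1) w0]
    by (auto simp: m_def[symmetric])
  then obtain x where xS: "\<And>n. x n \<in> S" and xm: "\<And>n. m - inverse (real (Suc n)) < norm (T (x n))"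
    by metis
  have xW: "\<And>n. x n \<in> W" and x1: "\<And>n. norm (x n) = 1" using xS by (auto simp: S_def)
  have lim_m: "(\<lambda>n. norm (T (x n))) \<longlonglongrightarrow> m"
  proof (rule tendsto_sandwich[of "\<lambda>n. m - inverse (real (Suc n))" _ _ "\<lambda>_. m"])
    show "(\<lambda>n. m - inverse (real (Suc n))) \<longlonglongrightarrow> m"
      using tendsto_diff[OF tendsto_const[of m] LIMSEQ_inverse_real_of_nat] by simp
  qed (intro always_eventually allI m_ge[OF xS] less_imp_le[OF xm] tendsto_const)+
  obtain r z where r: "strict_mono r" and z: "(\<lambda>n. T (x (r n))) \<longlonglongrightarrow> z"
    by (rule compact_on_sequencesE[OF T(2), of x]) (simp_all add: x1)
  have gap: "(norm (T (T (x n)) - m\<^sup>2 *\<^sub>R x n))\<^sup>2 \<le> m\<^sup>2 * (m\<^sup>2 - (norm (T (x n)))\<^sup>2)" for n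
  proof -
    have "norm (T (T (x n))) \<le> m * norm (T (x n))" by (intro m_bound W(3) xW)
    then have 1: "(norm (T (T (x n))))\<^sup>2 \<le> m\<^sup>2 * (norm (T (x n)))\<^sup>2"
      unfolding power_mult_distrib[symmetric] by (intro power_mono norm_ge_zero)
    have "cinner (T (T (x n))) (x n) = of_real ((norm (T (x n)))\<^sup>2)"
      by (simp only: TD(3)[of "T (x n)"] cinner_self)
    then have 2: "Re (cinner (T (T (x n))) (m\<^sup>2 *\<^sub>R x n)) = m\<^sup>2 * (norm (T (x n)))\<^sup>2"
      by (simp only: cinner_scaleR_right of_real_mult[symmetric] Re_complex_of_real)
    have 3: "(norm (m\<^sup>2 *\<^sub>R x n))\<^sup>2 = m\<^sup>2 * m\<^sup>2"
      by (simp add: x1 power2_eq_square)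
    show ?thesis
      unfolding norm_diff_square 2 3 using 1 by (simp add: right_diff_distrib)
  qed
  have "(\<lambda>n. m\<^sup>2 * (m\<^sup>2 - (norm (T (x n)))\<^sup>2)) \<longlonglongrightarrow> m\<^sup>2 * (m\<^sup>2 - m\<^sup>2)"
    by (intro tendsto_intros lim_m)
  then have bound_lim: "(\<lambda>n. m\<^sup>2 * (m\<^sup>2 - (norm (T (x n)))\<^sup>2)) \<longlonglongrightarrow> 0" by simp
  have "(\<lambda>n. (norm (T (T (x n)) - m\<^sup>2 *\<^sub>R x n))\<^sup>2) \<longlonglongrightarrow> 0"
    by (rule tendsto_sandwich[OF _ _ tendsto_const bound_lim];
        intro always_eventually allI gap zero_le_power2)
  from tendsto_real_sqrt[OF this]
  have "(\<lambda>n. norm (T (T (x n)) - m\<^sup>2 *\<^sub>R x n)) \<longlonglongrightarrow> 0"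
    by (simp only: real_sqrt_abs abs_norm_cancel real_sqrt_zero)
  from LIMSEQ_subseq_LIMSEQ[OF tendsto_norm_zero_cancel[OF this] r]
  have 1: "(\<lambda>n. T (T (x (r n))) - m\<^sup>2 *\<^sub>R x (r n)) \<longlonglongrightarrow> 0"
    by (simp only: comp_def)
  have 2: "(\<lambda>n. T (T (x (r n)))) \<longlonglongrightarrow> T z"
    by (rule bounded_linear.tendsto[OF bounded_operatorsD(1) z]) (rule TD(1))
  have "(\<lambda>n. m\<^sup>2 *\<^sub>R x (r n)) \<longlonglongrightarrow> T z"
    using tendsto_diff[OF 2 1] by simp
  from tendsto_scaleR[OF tendsto_const[of "1 / m\<^sup>2"] this]
have lim: "(\<lambda>n. x (r n)) \<longlonglongrightarrow> (1 / m\<^sup>2) *\<^sub>R T z"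
    using m0 by simp
  define l where "l = (1 / m\<^sup>2) *\<^sub>R T z"
  note lim = lim[folded l_def]
  have lW: "l \<in> W" using closed_sequentially[OF W(1) _ lim] xW by blast
  have l1: "norm l = 1" using LIMSEQ_unique[OF tendsto_norm[OF lim]] x1 by simp
  have "z = T l" using LIMSEQ_unique[OF z bounded_linear.tendsto[OF Tb(1) lim]] .
  then have TTl: "T (T l) = m\<^sup>2 *\<^sub>R l" using m0 by (simp add: l_def)
  show thesis
  proof (cases "T l = m *\<^sub>R l")
    case True
    then show thesis using that[of m l] m0 lW l1 by auto
  next
    case False
    define y where "y = T l - m *\<^sub>R l"
    have y0: "y \<noteq> 0" and yW: "y \<in> W"
      using False lW W by (auto simp: y_def subspace_diff subspace_scale)
    have "T y = (- m) *\<^sub>R y"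
      by (simp add: y_def Tb(4,5) TTl power2_eq_square scaleR_right_diff_distrib)
    then show thesis
      using that[of "- m" "(1 / norm y) *\<^sub>R y"] m0 y0 unit[OF yW y0]
      by (simp add: Tb(5) S_def)
  qed
qed

lemma closed_eigenspace:
  assumes "T \<in> bounded_operators"
  shows "closed {x. T x = c *\<^sub>R x}"
  by (rule closed_Collect_eq[OF linear_continuous_on[OF bounded_operatorsD(1)[OF assms]]
      continuous_on_scaleR[OF continuous_on_const continuous_on_id]])

definition joint_eigenspace ::
    "('h::complex_hilbert_space \<Rightarrow> 'h) set \<Rightarrow> (('h \<Rightarrow> 'h) \<Rightarrow> real) \<Rightarrow> 'h set"
  where "joint_eigenspace K f = {x. \<forall>T\<in>K. T x = f T *\<^sub>R x}"

lemma closed_csubspace_joint_eigenspace: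
  assumes K: "K \<subseteq> bounded_operators"
  shows "closed_csubspace (joint_eigenspace K f)"
proof -
  have KD: "T (x + y) = T x + T y" "T (c *\<^sub>C x) = c *\<^sub>C T x" "T 0 = 0"
    if "T \<in> K" for T x y c
    using bounded_operatorsD[of T] K that by auto
  have "joint_eigenspace K f = (\<Inter>T\<in>K. {x. T x = f T *\<^sub>R x})"
    by (auto simp: joint_eigenspace_def)
  then have "closed (joint_eigenspace K f)"
    using K by (auto intro!: closed_INT closed_eigenspace)
  then show ?thesis
    unfolding closed_csubspace_def joint_eigenspace_def
    by (auto simp: KD scaleC_add_right scaleR_scaleC scaleC_scaleC mult.commute)
qed

lemma joint_eigenspaces_orthogonal:
  assumes K: "\<And>T. T \<in> K \<Longrightarrow> hermitian T"
    and ne: "joint_eigenspace K f \<noteq> joint_eigenspace K g"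
    and x: "x \<in> joint_eigenspace K f" and y: "y \<in> joint_eigenspace K g"
  shows "cinner x y = 0"
proof -
  obtain T where T: "T \<in> K" "f T \<noteq> g T"
    using ne unfolding joint_eigenspace_def by fastforce
  have "cinner (T x) y = cinner x (T y)" by (rule hermitianD(3)[OF K[OF T(1)]])
  moreover have "T x = f T *\<^sub>R x" "T y = g T *\<^sub>R y"
    using x y T(1) by (auto simp: joint_eigenspace_def)
  ultimately have "of_real (f T) * cinner x y = of_real (g T) * cinner x y"
    by (simp only: cinner_scaleR_left cinner_scaleR_right)
  then show ?thesis using T(2) by simp
qed

text \<open>Otherwise the vectors orthogonal to all joint eigenspaces form a nonzero invariant
  subspace \<open>W\<close>, and \<open>W\<close> cannot be annihilated by \<open>K\<close>, as the common kernel is a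
  joint eigenspace.  So some member of \<open>K\<close> has an eigenspace in \<open>W\<close> for a nonzero
  eigenvalue, whose unit sphere \<open>S\<close> is compact.  A maximal set of eigenvalue equations that has a
  solution in \<open>S\<close> then prescribes an eigenvalue for every member of \<open>K\<close>, because the
  solutions form an invariant subspace, in which each member of \<open>K\<close> again has an eigenvector.
  This puts a joint eigenvector into \<open>W\<close>.\<close>

theorem joint_eigenspaces_total:
  fixes K :: "('h::complex_hilbert_space \<Rightarrow> 'h) set"
  assumes herm: "\<And>T. T \<in> K \<Longrightarrow> hermitian T"
    and cpt: "\<And>T. T \<in> K \<Longrightarrow> compact_on_sequences T"
    and comm: "\<And>S T x. S \<in> K \<Longrightarrow> T \<in> K \<Longrightarrow> S (T x) = T (S x)"
    and y: "\<And>f x. x \<in> joint_eigenspace K f \<Longrightarrow> cinner y x = 0"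
  shows "y = 0"
proof (rule ccontr)
  assume y0: "y \<noteq> 0"
  note KD = bounded_operatorsD[OF hermitianD(1)[OF herm]]
  define W where "W = (\<Inter>x\<in>(\<Union>f. joint_eigenspace K f). {y. cinner y x = 0})"
  have yW: "y \<in> W" using y by (auto simp: W_def)
  have W_perp: "cinner w x = 0" if "w \<in> W" "x \<in> joint_eigenspace K f" for w x f
    using that by (auto simp: W_def)
  have Wc: "closed W"
    unfolding W_def by (intro closed_INT ballI closed_Collect_eq continuous_intros
        linear_continuous_on bounded_linear_cinner_left)
  have Ws: "subspace W"
    by (auto simp: W_def subspace_def cinner_add_left cinner_scaleR_left)
  have WK: "T w \<in> W" if T: "T \<in> K" and w: "w \<in> W" for T w
  proof -
    have "cinner (T w) x = 0" if x: "x \<in> joint_eigenspace K f" for x f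
    proof -
      have "T x = f T *\<^sub>R x" using x T by (simp add: joint_eigenspace_def)
      then show ?thesis
        by (simp only: hermitianD(3)[OF herm[OF T]] cinner_scaleR_right W_perp[OF w x] mult_zero_right)
    qed
    then show ?thesis by (auto simp: W_def)
  qed
  have no_joint: "x \<notin> joint_eigenspace K f" if "x \<in> W" "x \<noteq> 0" for x f
    using W_perp[OF that(1)] that(2) by (metis cinner_self_eq_0_iff)
  obtain T\<^sub>0 w where T\<^sub>0: "T\<^sub>0 \<in> K" and w: "w \<in> W" "T\<^sub>0 w \<noteq> 0"
    using no_joint[OF yW y0, of "\<lambda>_. 0"] yW by (auto simp: joint_eigenspace_def)
  obtain c\<^sub>0 x\<^sub>0 where c\<^sub>0: "c\<^sub>0 \<noteq> 0" and x\<^sub>0: "x\<^sub>0 \<in> W" "norm x\<^sub>0 = 1" "T\<^sub>0 x\<^sub>0 = c\<^sub>0 *\<^sub>R x\<^sub>0"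
    using compact_hermitian_eigenvector[OF herm[OF T\<^sub>0] cpt[OF T\<^sub>0] Wc Ws WK[OF T\<^sub>0] w] by blast
  define E where "E = (\<lambda>(T :: 'h \<Rightarrow> 'h, c). {x. T x = c *\<^sub>R x})"
  define S where "S = W \<inter> E (T\<^sub>0, c\<^sub>0) \<inter> {x. norm x = 1}"
  have E_closed: "closed (E (T, c))" if "T \<in> K" for T c
    unfolding E_def using closed_eigenspace[OF hermitianD(1)[OF herm[OF that]]] by simp
  have S_closed: "closed S"
    unfolding S_def by (intro closed_Int Wc E_closed T\<^sub>0 closed_Collect_eq continuous_intros)
  have S_compact: "compact S"
    unfolding compact_def
  proof (intro allI impI)
    fix x :: "nat \<Rightarrow> 'h" assume x: "\<forall>n. x n \<in> S"
    then have "norm (x n) \<le> 1" for n by (simp add: S_def)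
    then obtain r l where r: "strict_mono r" and l: "(\<lambda>n. T\<^sub>0 (x (r n))) \<longlonglongrightarrow> l"
      using compact_on_sequencesE[OF cpt[OF T\<^sub>0]] by blast
    have "(\<lambda>n. (1 / c\<^sub>0) *\<^sub>R T\<^sub>0 (x (r n))) \<longlonglongrightarrow> (1 / c\<^sub>0) *\<^sub>R l"
      by (intro tendsto_intros l)
    moreover have "(1 / c\<^sub>0) *\<^sub>R T\<^sub>0 (x n) = x n" for n
      using x c\<^sub>0 by (simp add: S_def E_def)
    ultimately have lim: "(x \<circ> r) \<longlonglongrightarrow> (1 / c\<^sub>0) *\<^sub>R l" by (simp add: comp_def)
    moreover have "(1 / c\<^sub>0) *\<^sub>R l \<in> S"
      using closed_sequentially[OF S_closed _ lim] x by simp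
    ultimately show "\<exists>l\<in>S. \<exists>r. strict_mono r \<and> (x \<circ> r) \<longlonglongrightarrow> l" using r by blast
  qed
  define \<G> where "\<G> = {G. G \<subseteq> K \<times> UNIV \<and> S \<inter> (\<Inter>p\<in>G. E p) \<noteq> {}}"
  have "\<exists>G\<in>\<G>. \<forall>G'\<in>\<G>. G \<subseteq> G' \<longrightarrow> G' = G"
  proof (rule subset_Zorn_nonempty)
    have "x\<^sub>0 \<in> S" using x\<^sub>0 by (simp add: S_def E_def)
    then have "{} \<in> \<G>" by (auto simp: \<G>_def)
    then show "\<G> \<noteq> {}" by blast
    fix \<C> assume ne: "\<C> \<noteq> {}" and chain: "subset.chain \<G> \<C>"
    then have sub: "\<Union>\<C> \<subseteq> K \<times> UNIV" by (auto simp: subset.chain_def \<G>_def)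
    have "S \<inter> (\<Inter>p\<in>\<Union>\<C>. E p) \<noteq> {}"
    proof (rule compact_imp_fip_image[OF S_compact])
      show "closed (E p)" if "p \<in> \<Union>\<C>" for p
        using E_closed[of "fst p" "snd p"] sub that by auto
      fix I assume "finite I" "I \<subseteq> \<Union>\<C>"
      then obtain G where "G \<in> \<C>" "I \<subseteq> G"
        using finite_subset_Union_chain[OF _ _ ne chain] by metis
      moreover have "S \<inter> (\<Inter>p\<in>G. E p) \<noteq> {}"
        using \<open>G \<in> \<C>\<close> chain by (auto simp: subset.chain_def \<G>_def)
      ultimately show "S \<inter> (\<Inter>p\<in>I. E p) \<noteq> {}" by blast
    qed
    then show "\<Union>\<C> \<in> \<G>" using sub by (simp add: \<G>_def)
  qed
  then obtain G where G: "G \<in> \<G>" and max: "\<And>G'. G' \<in> \<G> \<Longrightarrow> G \<subseteq> G' \<Longrightarrow> G' = G" by blast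
  obtain v where v: "v \<in> S" "\<And>p. p \<in> G \<Longrightarrow> v \<in> E p" using G by (auto simp: \<G>_def)
  have GK: "G \<subseteq> K \<times> UNIV" using G by (simp add: \<G>_def)
  define V where "V = W \<inter> E (T\<^sub>0, c\<^sub>0) \<inter> (\<Inter>p\<in>G. E p)"
  have E_subspace: "subspace (E (T, c))" if "T \<in> K" for T c
    using KD[OF that] by (auto simp: subspace_def E_def scaleR_right_distrib)
  have E_inv: "T x \<in> E (T', c)" if "T \<in> K" "T' \<in> K" "x \<in> E (T', c)" for T T' c x
    using that comm[OF that(2,1)] KD(5)[OF that(1)] by (simp add: E_def)
  have Vc: "closed V"
    unfolding V_def using GK E_closed by (intro closed_Int closed_INT Wc E_closed T\<^sub>0) auto
  have Vs: "subspace V"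
    unfolding V_def using GK E_subspace
    by (intro subspace_inter subspace_Inter Ws E_subspace T\<^sub>0) auto
  have VK: "T x \<in> V" if "T \<in> K" "x \<in> V" for T x
    using that GK E_inv[OF that(1)] WK T\<^sub>0 unfolding V_def by blast
  have SV: "S \<inter> (\<Inter>p\<in>G. E p) = V \<inter> {x. norm x = 1}"
    by (auto simp: S_def V_def)
  have "\<exists>c. (T, c) \<in> G" if T: "T \<in> K" for T
  proof -
    have "\<exists>c x. x \<in> V \<and> norm x = 1 \<and> T x = c *\<^sub>R x"
    proof (cases "\<exists>u\<in>V. T u \<noteq> 0")
      case True
      then show ?thesis
        using compact_hermitian_eigenvector[OF herm[OF T] cpt[OF T] Vc Vs VK[OF T]] by metis
    next
      case False
      moreover have "v \<in> V" "norm v = 1" using v SV by blast+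
      ultimately show ?thesis by (metis scaleR_zero_left)
    qed
    then obtain c x where "x \<in> V" "norm x = 1" "T x = c *\<^sub>R x" by blast
    then have "x \<in> S \<inter> (\<Inter>p\<in>insert (T, c) G. E p)"
      using SV by (auto simp: E_def)
    then have "insert (T, c) G \<in> \<G>" using T GK unfolding \<G>_def by blast
    then show ?thesis using max by blast
  qed
  then obtain f where "\<And>T. T \<in> K \<Longrightarrow> (T, f T) \<in> G" by metis
  then have "v \<in> joint_eigenspace K f" using v by (fastforce simp: joint_eigenspace_def E_def)
  moreover have "v \<in> W" "v \<noteq> 0" using v by (auto simp: S_def)
  ultimately show False using no_joint by blast
qed

section \<open>Hermitian parts\<close>

lemma operator_algebra_combination:
  assumes \<A>: "operator_algebra \<A>" "A \<in> \<A>" "B \<in> \<A>"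
  shows "(\<lambda>x. a *\<^sub>C A x + b *\<^sub>C B x) \<in> \<A>"
proof -
  have "(\<lambda>x. a *\<^sub>C A x) \<in> \<A>" "(\<lambda>x. b *\<^sub>C B x) \<in> \<A>"
    using \<A> by (auto simp: operator_algebra_def)
  then show ?thesis
    using \<A>(1) unfolding operator_algebra_def by meson
qed

lemma hermitian_combination:
  assumes A: "A \<in> bounded_operators"
  shows "hermitian (\<lambda>x. c *\<^sub>C A x + cnj c *\<^sub>C cadjoint A x)"
proof -
  note A' = cadjoint_bounded[OF A]
  have "cadjoint (\<lambda>x. c *\<^sub>C A x + cnj c *\<^sub>C cadjoint A x)
      = (\<lambda>x. cnj c *\<^sub>C cadjoint A x + cnj (cnj c) *\<^sub>C cadjoint (cadjoint A) x)"
    by (simp only: cadjoint_add[OF bounded_operators_scaleC[OF A] bounded_operators_scaleC[OF A']]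
        cadjoint_scaleC[OF A] cadjoint_scaleC[OF A'])
  then show ?thesis
    unfolding hermitian_def
    by (simp add: A A' bounded_operators_add bounded_operators_scaleC cadjoint_cadjoint add.commute)
qed

text \<open>For \<open>c = 1\<close> and \<open>c = \<i>\<close> the hermitian combinations are twice the real part and \<open>- 2\<close>
  times the imaginary part of \<open>A\<close>, so \<open>A\<close> is a linear combination of these two.\<close>

lemma commutes_if_commutes_hermitian_parts:
  fixes S A :: "'h::complex_hilbert_space \<Rightarrow> 'h"
  assumes S: "S \<in> bounded_operators"
    and comm: "\<And>c x. S (c *\<^sub>C A x + cnj c *\<^sub>C cadjoint A x)
      = c *\<^sub>C A (S x) + cnj c *\<^sub>C cadjoint A (S x)"
  shows "S (A x) = A (S x)"
proof -
  note SD = bounded_operatorsD[OF S]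
  define p q where "p = S (A x) - A (S x)" and "q = S (cadjoint A x) - cadjoint A (S x)"
  have eq: "c *\<^sub>C p + cnj c *\<^sub>C q = 0" for c
    using comm[of c x] by (simp add: SD p_def q_def scaleC_diff_right algebra_simps)
  have "p + q = 0" using eq[of 1] by (simp add: scaleC_one)
  moreover have "p - q = (- \<i>) *\<^sub>C (\<i> *\<^sub>C p + cnj \<i> *\<^sub>C q)"
    by (simp add: scaleC_add_right scaleC_scaleC scaleC_one uminus_scaleC[symmetric])
  then have "p - q = 0" by (simp only: eq scaleC_zero_right)
  ultimately have "2 *\<^sub>R p = 0" by (simp add: scaleR_2 add_eq_0_iff)
  then show ?thesis by (simp add: p_def)
qed

text \<open>A normal operator and its adjoint satisfy \<open>norm (cadjoint A x) = norm (A x)\<close>, so they map the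
  same sequences to Cauchy sequences.\<close>

lemma compact_combination_normal:
  assumes A: "A \<in> bounded_operators" "compact_on_sequences A"
    and normal: "A \<circ> cadjoint A = cadjoint A \<circ> A"
  shows "compact_on_sequences (\<lambda>x. a *\<^sub>C A x + b *\<^sub>C cadjoint A x)"
  unfolding compact_on_sequences_def
proof (intro allI impI)
  fix x :: "nat \<Rightarrow> 'a" assume x: "\<forall>n. norm (x n) \<le> 1"
  note A' = cadjoint_bounded[OF A(1)]
  have norm_eq: "norm (cadjoint A y) = norm (A y)" for y
  proof -
    have "cinner (cadjoint A y) (cadjoint A y) = cinner (A (cadjoint A y)) y"
      by (rule cinner_cadjoint_right[OF A(1)])
    also have "\<dots> = cinner (cadjoint A (A y)) y"
      using fun_cong[OF normal, of y] by (simp only: comp_apply)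
    also have "\<dots> = cinner (A y) (A y)" by (rule cinner_cadjoint_left[OF A(1)])
    finally have "complex_of_real ((norm (cadjoint A y))\<^sup>2) = of_real ((norm (A y))\<^sup>2)"
      by (simp only: cinner_self)
    then show ?thesis unfolding of_real_eq_iff by (simp add: power2_eq_iff_nonneg)
  qed
  obtain r l where r: "strict_mono r" and l: "(\<lambda>n. A (x (r n))) \<longlonglongrightarrow> l"
    by (rule compact_on_sequencesE[OF A(2), of x]) (use x in auto)
  have "Cauchy (\<lambda>n. A (x (r n)))" by (rule LIMSEQ_imp_Cauchy[OF l])
  then have "Cauchy (\<lambda>n. cadjoint A (x (r n)))"
    unfolding Cauchy_def dist_norm
    by (simp only: bounded_operatorsD(4)[OF A(1), symmetric] bounded_operatorsD(4)[OF A', symmetric]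
        norm_eq)
  then obtain l' where l': "(\<lambda>n. cadjoint A (x (r n))) \<longlonglongrightarrow> l'"
    using Cauchy_convergent convergent_def by blast
  have scale: "(\<lambda>n. c *\<^sub>C y n) \<longlonglongrightarrow> c *\<^sub>C k" if "y \<longlonglongrightarrow> k" for c k and y :: "nat \<Rightarrow> 'a"
    using bounded_linear.tendsto[OF bounded_operatorsD(1) that,
        OF bounded_operators_scaleC[OF bounded_operators_id]] by simp
  have "(\<lambda>n. a *\<^sub>C A (x (r n)) + b *\<^sub>C cadjoint A (x (r n))) \<longlonglongrightarrow> a *\<^sub>C l + b *\<^sub>C l'"
    by (intro tendsto_add scale l l')
  then show "\<exists>r. strict_mono r \<and> convergent (\<lambda>n. a *\<^sub>C A (x (r n)) + b *\<^sub>C cadjoint A (x (r n)))"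
    using r convergent_def by blast
qed

lemma hermitian_conjugate:
  assumes "unitary_operator V" "hermitian T"
  shows "hermitian (cadjoint V \<circ> T \<circ> V)"
  using unitary_operatorD(1)[OF assms(1)] hermitianD(1,2)[OF assms(2)] unfolding hermitian_def
  by (simp add: bounded_operators_comp cadjoint_bounded cadjoint_comp cadjoint_cadjoint comp_assoc)

lemma compact_on_sequences_conjugate:
  assumes V: "unitary_operator V" and T: "compact_on_sequences T"
  shows "compact_on_sequences (cadjoint V \<circ> T \<circ> V)"
  unfolding compact_on_sequences_def
proof (intro allI impI)
  fix x :: "nat \<Rightarrow> 'a" assume x: "\<forall>n. norm (x n) \<le> 1"
  note VD = unitary_operatorD[OF V]
  obtain r l where r: "strict_mono r" and l: "(\<lambda>n. T (V (x (r n)))) \<longlonglongrightarrow> l"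
    by (rule compact_on_sequencesE[OF T, of "\<lambda>n. V (x n)"]) (use x VD(5) in auto)
  have "(\<lambda>n. cadjoint V (T (V (x (r n))))) \<longlonglongrightarrow> cadjoint V l"
    by (rule bounded_linear.tendsto[OF bounded_operatorsD(1)[OF cadjoint_bounded[OF VD(1)]] l])
  then show "\<exists>r. strict_mono r \<and> convergent (\<lambda>n. (cadjoint V \<circ> T \<circ> V) (x (r n)))"
    using r by (auto simp: convergent_def)
qed

section \<open>Maximal invariant commuting families\<close>

text \<open>A family is a bare set of operators, so that it can be enlarged by single orbits under
  conjugation.  The maximal families of interest become algebras by being commutants.\<close>

definition invariant_commuting ::
    "('h::complex_hilbert_space \<Rightarrow> 'h) set \<Rightarrow> ('h \<Rightarrow> 'h) set \<Rightarrow> bool"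
  where "invariant_commuting G F \<longleftrightarrow>
    F \<subseteq> bounded_operators \<and>
    (\<forall>A\<in>F. cadjoint A \<in> F) \<and>
    (\<forall>A\<in>F. \<forall>B\<in>F. \<forall>x. A (B x) = B (A x)) \<and>
    (\<forall>V\<in>G. \<forall>A\<in>F. cadjoint V \<circ> A \<circ> V \<in> F)"

lemma invariant_commutingI:
  assumes "\<And>A. A \<in> F \<Longrightarrow> A \<in> bounded_operators" "\<And>A. A \<in> F \<Longrightarrow> cadjoint A \<in> F"
    "\<And>A B x. A \<in> F \<Longrightarrow> B \<in> F \<Longrightarrow> A (B x) = B (A x)"
    "\<And>V A. V \<in> G \<Longrightarrow> A \<in> F \<Longrightarrow> cadjoint V \<circ> A \<circ> V \<in> F"
  shows "invariant_commuting G F"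
  using assms unfolding invariant_commuting_def by blast

lemma invariant_commutingD:
  assumes "invariant_commuting G F"
  shows "A \<in> F \<Longrightarrow> A \<in> bounded_operators" "A \<in> F \<Longrightarrow> cadjoint A \<in> F"
    "A \<in> F \<Longrightarrow> B \<in> F \<Longrightarrow> A (B x) = B (A x)"
    "V \<in> G \<Longrightarrow> A \<in> F \<Longrightarrow> cadjoint V \<circ> A \<circ> V \<in> F"
  using assms unfolding invariant_commuting_def by blast+

lemma maximal_invariant_commuting_exists:
  assumes "invariant_commuting G F"
  obtains M where "invariant_commuting G M" "F \<subseteq> M"
    "\<And>N. invariant_commuting G N \<Longrightarrow> M \<subseteq> N \<Longrightarrow> N = M"
proof -
  let ?\<F> = "{N. invariant_commuting G N \<and> F \<subseteq> N}"
  have "\<exists>M\<in>?\<F>. \<forall>N\<in>?\<F>. M \<subseteq> N \<longrightarrow> N = M"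
  proof (rule subset_Zorn_nonempty)
    show "?\<F> \<noteq> {}" using assms by blast
    fix \<C> assume ne: "\<C> \<noteq> {}" and chain: "subset.chain ?\<F> \<C>"
    then have inv: "invariant_commuting G N" and "F \<subseteq> N" if "N \<in> \<C>" for N
      using that by (auto simp: subset.chain_def)
    have "invariant_commuting G (\<Union>\<C>)"
    proof (rule invariant_commutingI)
      show "A (B x) = B (A x)" if AB: "A \<in> \<Union>\<C>" "B \<in> \<Union>\<C>" for A B x
      proof -
        obtain N N' where N: "N \<in> \<C>" "A \<in> N" "N' \<in> \<C>" "B \<in> N'" using AB by blast
        then have "N \<subseteq> N' \<or> N' \<subseteq> N" using chain unfolding subset_chain_def by blast
        then obtain L where "L \<in> \<C>" "A \<in> L" "B \<in> L" using N by blast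
        then show ?thesis using invariant_commutingD(3)[OF inv] by blast
      qed
    qed (use invariant_commutingD(1,2,4)[OF inv] in blast)+
    then show "\<Union>\<C> \<in> ?\<F>" using ne \<open>\<And>N. N \<in> \<C> \<Longrightarrow> F \<subseteq> N\<close> by blast
  qed
  then show thesis using that by (smt (verit, best) mem_Collect_eq order_trans)
qed

locale unitary_group_on_compacts =
  fixes G K :: "('h::complex_hilbert_space \<Rightarrow> 'h) set"
  assumes unitary: "V \<in> G \<Longrightarrow> unitary_operator V"
    and id_in: "id \<in> G"
    and comp_in: "V \<in> G \<Longrightarrow> W \<in> G \<Longrightarrow> V \<circ> W \<in> G"
    and cadjoint_in: "V \<in> G \<Longrightarrow> cadjoint V \<in> G"
    and G_commute: "V \<in> G \<Longrightarrow> W \<in> G \<Longrightarrow> V (W x) = W (V x)"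
    and K_hermitian: "T \<in> K \<Longrightarrow> hermitian T"
    and K_compact: "T \<in> K \<Longrightarrow> compact_on_sequences T"
    and K_commute: "S \<in> K \<Longrightarrow> T \<in> K \<Longrightarrow> S (T x) = T (S x)"
    and K_invariant: "V \<in> G \<Longrightarrow> T \<in> K \<Longrightarrow> cadjoint V \<circ> T \<circ> V \<in> K"
begin

abbreviation "eigenspaces \<equiv> range (joint_eigenspace K)"

abbreviation "P \<equiv> orthogonal_projection"

lemmas G_bounded = unitary_operatorD(1)[OF unitary]
lemmas G_cancel [simp] = unitary_operatorD(2,3)[OF unitary]

lemma cancel_image [simp]: "V \<in> G \<Longrightarrow> cadjoint V ` V ` X = X" "V \<in> G \<Longrightarrow> V ` cadjoint V ` X = X"
  by (simp_all add: image_image)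

lemma eigenspace_closed: "X \<in> eigenspaces \<Longrightarrow> closed_csubspace X"
  using closed_csubspace_joint_eigenspace[of K] hermitianD(1)[OF K_hermitian] by auto

lemma eigenspaces_orthogonal:
  "X \<in> eigenspaces \<Longrightarrow> Y \<in> eigenspaces \<Longrightarrow> X \<noteq> Y \<Longrightarrow> x \<in> X \<Longrightarrow> y \<in> Y \<Longrightarrow> cinner x y = 0"
  using joint_eigenspaces_orthogonal[OF K_hermitian] by blast

text \<open>\<open>V\<close> carries the joint eigenspace of \<open>f\<close> to that of the composition of \<open>f\<close>
  with conjugation by \<open>V\<close>.\<close>

lemma image_eigenspace:
  assumes V: "V \<in> G" and X: "X \<in> eigenspaces"
  shows "V ` X \<in> eigenspaces"
proof -
  obtain f where f: "X = joint_eigenspace K f" using X by blast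
  define g where "g = (\<lambda>T. f (cadjoint V \<circ> T \<circ> V))"
  note VD = bounded_operatorsD(5)[OF G_bounded[OF V]]
    bounded_operatorsD(5)[OF G_bounded[OF cadjoint_in[OF V]]]
  have "V ` X = joint_eigenspace K g"
  proof (intro set_eqI iffI)
    fix y assume "y \<in> V ` X"
    then obtain x where x: "x \<in> X" "y = V x" by blast
    have "T (V x) = g T *\<^sub>R V x" if T: "T \<in> K" for T
    proof -
      have "(cadjoint V \<circ> T \<circ> V) x = g T *\<^sub>R x"
        using x(1) K_invariant[OF V T] by (simp add: f joint_eigenspace_def g_def)
      then have "V (cadjoint V (T (V x))) = V (g T *\<^sub>R x)" by simp
      then show ?thesis by (simp add: V VD)
    qed
    then show "y \<in> joint_eigenspace K g" by (simp add: joint_eigenspace_def x)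
  next
    fix y assume y: "y \<in> joint_eigenspace K g"
    have "T (cadjoint V y) = f T *\<^sub>R cadjoint V y" if T: "T \<in> K" for T
    proof -
      have "V \<circ> T \<circ> cadjoint V \<in> K"
        using K_invariant[OF cadjoint_in[OF V] T] by (simp add: cadjoint_cadjoint G_bounded V)
      then have "(V \<circ> T \<circ> cadjoint V) y = g (V \<circ> T \<circ> cadjoint V) *\<^sub>R y"
        using y by (simp add: joint_eigenspace_def)
      moreover have "cadjoint V \<circ> (V \<circ> T \<circ> cadjoint V) \<circ> V = T"
        by (simp add: fun_eq_iff V)
      ultimately have "cadjoint V (V (T (cadjoint V y))) = cadjoint V (f T *\<^sub>R y)"
        by (simp add: g_def)
      then show ?thesis by (simp add: V VD)
    qed
    then have "cadjoint V y \<in> X" by (simp add: f joint_eigenspace_def)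
    then have "V (cadjoint V y) \<in> V ` X" by blast
    then show "y \<in> V ` X" by (simp add: V)
  qed
  then show ?thesis by blast
qed

lemma projection_image:
  assumes "V \<in> G" "X \<in> eigenspaces"
  shows "P (V ` X) (V x) = V (P X x)"
  by (rule orthogonal_projection_unitary[OF eigenspace_closed[OF assms(2)] unitary[OF assms(1)]])

lemma projection_commutes_K:
  assumes X: "X \<in> eigenspaces" and T: "T \<in> K"
  shows "P X (T x) = T (P X x)"
proof -
  have "T y \<in> X" if "y \<in> X" for y
  proof -
    obtain f where f: "X = joint_eigenspace K f" using X by blast
    then have "T y = f T *\<^sub>R y" using that T by (simp add: joint_eigenspace_def)
    then show ?thesis using closed_csubspaceD(5)[OF eigenspace_closed[OF X] that] by simp
  qed
  then show ?thesis
    by (intro orthogonal_projection_reducing[OF eigenspace_closed[OF X]])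
      (simp_all add: hermitianD(1,2)[OF K_hermitian[OF T]])
qed

lemma operators_agree_on_eigenspaces:
  assumes ST: "S \<in> bounded_operators" "T \<in> bounded_operators"
    and agree: "\<And>X x. X \<in> eigenspaces \<Longrightarrow> x \<in> X \<Longrightarrow> S x = T x"
  shows "S x = T x"
proof -
  define D where "D = {x. S x = T x}"
  have D: "closed_csubspace D"
    unfolding D_def closed_csubspace_def
    using bounded_operatorsD[OF ST(1)] bounded_operatorsD[OF ST(2)]
    by (auto intro!: closed_Collect_eq linear_continuous_on)
  have "x - P D x = 0"
  proof (rule joint_eigenspaces_total[where K = K])
    fix f z assume "z \<in> joint_eigenspace K f"
    then have "z \<in> D" using agree unfolding D_def by blast
    then show "cinner (x - P D x) z = 0" by (rule orthogonal_projection_perp[OF D])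
  qed (use K_hermitian K_compact K_commute in auto)
  then have "x \<in> D" using orthogonal_projection_in[OF D, of x] by simp
  then show ?thesis by (simp add: D_def)
qed

text \<open>The restrictions of the unitaries in \<open>G\<close> to the joint eigenspaces that they map onto
  themselves, extended by zero.  Including them in a maximal family forces its commutant to
  commute with the action of every stabilizer on its eigenspace.\<close>

definition local_unitaries :: "('h \<Rightarrow> 'h) set"
  where "local_unitaries = {Z \<circ> P X |Z X. Z \<in> G \<and> X \<in> eigenspaces \<and> Z ` X = X}"

lemma local_unitaries_commute_K:
  assumes T: "T \<in> K" and B: "B \<in> local_unitaries"
  shows "T (B x) = B (T x)"
proof -
  obtain Z X where Z: "Z \<in> G" "X \<in> eigenspaces" "Z ` X = X" and B: "B = Z \<circ> P X"
    using B by (auto simp: local_unitaries_def)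
  obtain f where f: "X = joint_eigenspace K f" using Z by blast
  have scalar: "T y = f T *\<^sub>R y" if "y \<in> X" for y
    using that T by (simp add: f joint_eigenspace_def)
  have in_X: "P X x \<in> X" by (rule orthogonal_projection_in[OF eigenspace_closed[OF Z(2)]])
  have ZX: "Z (P X x) \<in> X" using imageI[OF in_X, of Z] by (simp add: Z)
  show ?thesis
    by (simp add: B projection_commutes_K[OF Z(2) T] scalar[OF in_X] scalar[OF ZX]
        bounded_operatorsD(5)[OF G_bounded[OF Z(1)]])
qed

lemma local_unitaries_commute:
  assumes A: "A \<in> local_unitaries" and B: "B \<in> local_unitaries"
  shows "A (B x) = B (A x)"
proof -
  obtain Z X where Z: "Z \<in> G" "X \<in> eigenspaces" "Z ` X = X" "A = Z \<circ> P X"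
    using A by (auto simp: local_unitaries_def)
  obtain W Y where W: "W \<in> G" "Y \<in> eigenspaces" "W ` Y = Y" "B = W \<circ> P Y"
    using B by (auto simp: local_unitaries_def)
  note X = eigenspace_closed[OF Z(2)] and Y = eigenspace_closed[OF W(2)]
  have ZX: "Z (P X u) \<in> X" for u
    using imageI[OF orthogonal_projection_in[OF X, of u], of Z] by (simp add: Z)
  have WY: "W (P Y u) \<in> Y" for u
    using imageI[OF orthogonal_projection_in[OF Y, of u], of W] by (simp add: W)
  show ?thesis
  proof (cases "X = Y")
    case True
    then show ?thesis
      using orthogonal_projection_fixes[OF X ZX] orthogonal_projection_fixes[OF Y WY]
      by (simp add: Z(4) W(4) G_commute[OF Z(1) W(1)])
  next
    case False
    have "P X (W (P Y x)) = 0"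
      using eigenspaces_orthogonal[OF W(2) Z(2)] False WY
      by (intro orthogonal_projection_kills[OF X]) blast
    moreover have "P Y (Z (P X x)) = 0"
      using eigenspaces_orthogonal[OF Z(2) W(2) False ZX]
      by (intro orthogonal_projection_kills[OF Y]) blast
    ultimately show ?thesis
      by (simp add: Z(4) W(4) bounded_operatorsD(6)[OF G_bounded[OF Z(1)]]
          bounded_operatorsD(6)[OF G_bounded[OF W(1)]])
  qed
qed

lemma invariant_commuting_base: "invariant_commuting G (K \<union> local_unitaries)"
proof (rule invariant_commutingI)
  fix A assume "A \<in> K \<union> local_unitaries"
  then show "A \<in> bounded_operators"
    using bounded_operators_comp[OF G_bounded orthogonal_projection_bounded[OF eigenspace_closed]]
      hermitianD(1)[OF K_hermitian]
    unfolding local_unitaries_def by blast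
next
  fix A assume "A \<in> K \<union> local_unitaries"
  then show "cadjoint A \<in> K \<union> local_unitaries"
  proof
    assume "A \<in> local_unitaries"
    then obtain Z X where Z: "Z \<in> G" "X \<in> eigenspaces" "Z ` X = X" and A: "A = Z \<circ> P X"
      by (auto simp: local_unitaries_def)
    note X = eigenspace_closed[OF Z(2)]
    have Z'X: "cadjoint Z ` X = X" using cancel_image(1)[OF Z(1), of X] by (simp add: Z(3))
    have "cadjoint A = P X \<circ> cadjoint Z"
      unfolding A
      by (simp add: cadjoint_comp G_bounded Z(1) orthogonal_projection_bounded[OF X]
          cadjoint_orthogonal_projection[OF X])
    also have "\<dots> = cadjoint Z \<circ> P X"
      using projection_image[OF cadjoint_in[OF Z(1)] Z(2)] by (simp add: fun_eq_iff Z'X)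
    finally show ?thesis
      using Z'X Z(2) cadjoint_in[OF Z(1)] unfolding local_unitaries_def by blast
  qed (use hermitianD(2)[OF K_hermitian] in simp)
next
  fix A B x assume "A \<in> K \<union> local_unitaries" "B \<in> K \<union> local_unitaries"
  then show "A (B x) = B (A x)"
    using K_commute local_unitaries_commute local_unitaries_commute_K by (elim UnE) auto
next
  fix V A assume V: "V \<in> G" and "A \<in> K \<union> local_unitaries"
  then show "cadjoint V \<circ> A \<circ> V \<in> K \<union> local_unitaries"
  proof (elim UnE)
    assume "A \<in> local_unitaries"
    then obtain Z X where Z: "Z \<in> G" "X \<in> eigenspaces" "Z ` X = X" and A: "A = Z \<circ> P X"
      by (auto simp: local_unitaries_def)
    define Y where "Y = cadjoint V ` X"
    have Y: "Y \<in> eigenspaces" unfolding Y_def by (rule image_eigenspace[OF cadjoint_in[OF V] Z(2)])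
    have VY: "V ` Y = X" by (simp add: Y_def V)
    have "Z ` Y = cadjoint V ` Z ` X"
      by (simp add: Y_def image_image G_commute[OF Z(1) cadjoint_in[OF V]])
    then have ZY: "Z ` Y = Y" by (simp add: Z(3) Y_def)
    have "(cadjoint V \<circ> A \<circ> V) x = (Z \<circ> P Y) x" for x
      using projection_image[OF V Y, of x]
      by (simp add: A VY G_commute[OF Z(1) V] V)
    then have "cadjoint V \<circ> A \<circ> V = Z \<circ> P Y" by blast
    then show ?thesis using Z(1) Y ZY unfolding local_unitaries_def by blast
  qed (use K_invariant V in blast)
qed

text \<open>The conjugates of \<open>T \<circ> P X\<close> can be adjoined to \<open>M\<close>: two of them live on
  orthogonal eigenspaces or coincide, since the unitaries that map \<open>X\<close> onto itself act on \<open>X\<close>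
  through members of \<open>M\<close>, with which \<open>T\<close> commutes.  The conjugates are self-adjoint because \<open>T\<close>
  is; for general \<open>T\<close> the adjoints would have to be adjoined as well and need not commute
  with the conjugates.\<close>

lemma maximal_absorbs:
  assumes M: "invariant_commuting G M" and base: "K \<union> local_unitaries \<subseteq> M"
    and max: "\<And>N. invariant_commuting G N \<Longrightarrow> M \<subseteq> N \<Longrightarrow> N = M"
    and T: "T \<in> commutant M" "hermitian T" and X: "X \<in> eigenspaces"
  shows "T \<circ> P X \<in> M"
proof -
  note MD = invariant_commutingD[OF M] and TD = hermitianD[OF T(2)]
    and Xc = eigenspace_closed[OF X]
  note Pb = orthogonal_projection_bounded[OF Xc]
  have local_in: "Z \<circ> P X \<in> M" if "Z \<in> G" "Z ` X = X" for Z
    using base that X unfolding local_unitaries_def by blast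
  have PM: "P X \<in> M" using local_in[OF id_in] by simp
  have TP: "T (P X x) = P X (T x)" for x by (rule commutantD(2)[OF T(1) PM])
  define Q where "Q = (\<lambda>V. V \<circ> (T \<circ> P X) \<circ> cadjoint V)"
  have Qb: "Q V \<in> bounded_operators" if "V \<in> G" for V
    unfolding Q_def by (intro bounded_operators_comp cadjoint_bounded G_bounded that TD Pb)
  have Q_adj: "cadjoint (Q V) = Q V" if V: "V \<in> G" for V
  proof -
    note Vb = G_bounded[OF V]
    have "cadjoint (Q V) = V \<circ> (P X \<circ> T) \<circ> cadjoint V"
      unfolding Q_def
      by (simp add: cadjoint_comp bounded_operators_comp cadjoint_bounded Vb TD Pb
          cadjoint_cadjoint cadjoint_orthogonal_projection[OF Xc] comp_assoc)
    then show ?thesis by (simp add: Q_def fun_eq_iff TP)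
  qed
  have Q_conj: "cadjoint W \<circ> Q V \<circ> W = Q (cadjoint W \<circ> V)" if "V \<in> G" "W \<in> G" for V W
    by (simp add: Q_def cadjoint_comp cadjoint_cadjoint cadjoint_bounded G_bounded that comp_assoc)
  have Q_M: "Q V (B x) = B (Q V x)" if V: "V \<in> G" and B: "B \<in> M" for V B x
  proof -
    define B' where "B' = cadjoint V \<circ> B \<circ> V"
    have B': "B' \<in> M" unfolding B'_def by (rule MD(4)[OF V B])
    have 1: "cadjoint V (B y) = B' (cadjoint V y)" and 2: "V (B' y) = B (V y)" for y
      by (simp_all add: B'_def V)
    show ?thesis
      by (simp add: Q_def 1 MD(3)[OF PM B'] commutantD(2)[OF T(1) B'] 2)
  qed
  have Q_same: "Q V = Q W" if V: "V \<in> G" and W: "W \<in> G" and stab: "(cadjoint W \<circ> V) ` X = X" for V W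
  proof
    fix x
    define Z where "Z = cadjoint W \<circ> V"
    have Z: "Z \<in> G" "Z ` X = X" using stab comp_in[OF cadjoint_in[OF W] V] by (simp_all add: Z_def)
    define y where "y = cadjoint V x"
    have Zy: "Z y = cadjoint W x" and WZ: "W (Z u) = V u" for u
      by (simp_all add: Z_def y_def V W)
    have "Z (T (P X y)) = (Z \<circ> P X) (T y)" by (simp add: TP)
    also have "\<dots> = T (Z (P X y))" using commutantD(2)[OF T(1) local_in[OF Z], of y] by simp
    also have "Z (P X y) = P X (Z y)" using projection_image[OF Z(1) X, of y] by (simp add: Z(2))
    finally have "W (Z (T (P X y))) = W (T (P X (cadjoint W x)))" by (simp add: Zy)
    then show "Q V x = Q W x" by (simp add: WZ Q_def y_def)
  qed
  have Q_zero: "Q V (Q W x) = 0"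
    if V: "V \<in> G" and W: "W \<in> G" and ns: "(cadjoint V \<circ> W) ` X \<noteq> X" for V W x
  proof -
    have VW: "cadjoint V \<circ> W \<in> G" by (intro comp_in cadjoint_in V W)
    have "P X (T (cadjoint W x)) \<in> X" by (rule orthogonal_projection_in[OF Xc])
    then have "(cadjoint V \<circ> W) (T (P X (cadjoint W x))) \<in> (cadjoint V \<circ> W) ` X"
      unfolding TP by (rule imageI)
    then have "P X ((cadjoint V \<circ> W) (T (P X (cadjoint W x)))) = 0"
      using eigenspaces_orthogonal[OF image_eigenspace[OF VW X] X ns]
      by (intro orthogonal_projection_kills[OF Xc]) blast
    then show ?thesis
      by (simp add: Q_def bounded_operatorsD(6)[OF TD(1)] bounded_operatorsD(6)[OF G_bounded[OF V]])
  qed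
  have Q_Q: "Q V (Q W x) = Q W (Q V x)" if V: "V \<in> G" and W: "W \<in> G" for V W x
  proof (cases "(cadjoint W \<circ> V) ` X = X")
    case True
    then show ?thesis using Q_same[OF V W] by simp
  next
    case False
    moreover have "(cadjoint V \<circ> W) ` X \<noteq> X"
    proof
      assume "(cadjoint V \<circ> W) ` X = X"
      then have "(cadjoint W \<circ> V) ` (cadjoint V \<circ> W) ` X = (cadjoint W \<circ> V) ` X" by (rule arg_cong)
      then show False using False by (simp add: image_image V W)
    qed
    ultimately show ?thesis using Q_zero V W by simp
  qed
  have "invariant_commuting G (M \<union> Q ` G)"
  proof (rule invariant_commutingI)
    fix A B x assume "A \<in> M \<union> Q ` G" "B \<in> M \<union> Q ` G"
    then show "A (B x) = B (A x)" using MD(3) Q_M Q_Q by (elim UnE) auto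
  next
    fix W A assume W: "W \<in> G" and "A \<in> M \<union> Q ` G"
    then show "cadjoint W \<circ> A \<circ> W \<in> M \<union> Q ` G"
      using MD(4) Q_conj[OF _ W] comp_in[OF cadjoint_in[OF W]] by auto
  qed (use MD Qb Q_adj in auto)
  then have "M \<union> Q ` G = M" by (rule max) blast
  moreover have "Q id = T \<circ> P X" by (simp add: Q_def cadjoint_id)
  ultimately show ?thesis using id_in by (metis UnCI imageI)
qed

text \<open>By the absorption lemma, a hermitian member of the commutant of a maximal family commutes with
  that whole commutant on each joint eigenspace, hence everywhere.  So the commutant is itself
  an invariant commuting family, and by maximality it equals the family.\<close>

theorem invariant_masa_exists:
  obtains M where "masa M" "K \<subseteq> M" "commutant M = M"
    "\<And>V A. V \<in> G \<Longrightarrow> A \<in> M \<Longrightarrow> cadjoint V \<circ> A \<circ> V \<in> M"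
proof -
  obtain M where M: "invariant_commuting G M" and base: "K \<union> local_unitaries \<subseteq> M"
    and max: "\<And>N. invariant_commuting G N \<Longrightarrow> M \<subseteq> N \<Longrightarrow> N = M"
    using maximal_invariant_commuting_exists[OF invariant_commuting_base] by blast
  note MD = invariant_commutingD[OF M]
  have Mb: "M \<subseteq> bounded_operators" using MD(1) by blast
  let ?C = "commutant M"
  have C_alg: "operator_algebra ?C" by (rule operator_algebra_commutant[OF Mb])
  have C_adj: "cadjoint T \<in> ?C" if "T \<in> ?C" for T
    by (rule cadjoint_in_commutant[OF Mb MD(2) that])
  have hermitian_central: "S (T x) = T (S x)"
    if S: "S \<in> ?C" and T: "T \<in> ?C" "hermitian T" for S T x
  proof -
    have "(S \<circ> T) x = (T \<circ> S) x"
    proof (rule operators_agree_on_eigenspaces[where S = "S \<circ> T" and T = "T \<circ> S"])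
      fix X x assume X: "X \<in> eigenspaces" and x: "x \<in> X"
      have TP: "T \<circ> P X \<in> M" by (rule maximal_absorbs[OF M base max T X])
      have "id \<circ> P X \<in> local_unitaries" unfolding local_unitaries_def using id_in X by fastforce
      then have PM: "P X \<in> M" using base by auto
      have Px: "P X x = x" by (rule orthogonal_projection_fixes[OF eigenspace_closed[OF X] x])
      have "S ((T \<circ> P X) x) = (T \<circ> P X) (S x)" by (rule commutantD(2)[OF S TP])
      moreover have "S (P X x) = P X (S x)" by (rule commutantD(2)[OF S PM])
      ultimately show "(S \<circ> T) x = (T \<circ> S) x" by (simp add: Px)
    qed (intro bounded_operators_comp commutantD(1)[OF S] commutantD(1)[OF T(1)])+
    then show ?thesis by simp
  qed
  have C_comm: "S (T x) = T (S x)" if S: "S \<in> ?C" and T: "T \<in> ?C" for S T x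
  proof (rule commutes_if_commutes_hermitian_parts[where S = S and A = T, OF commutantD(1)[OF S]])
    fix c x
    have "(\<lambda>x. c *\<^sub>C T x + cnj c *\<^sub>C cadjoint T x) \<in> ?C"
      by (rule operator_algebra_combination[OF C_alg T C_adj[OF T]])
    from hermitian_central[OF S this hermitian_combination[OF commutantD(1)[OF T]], of x]
    show "S (c *\<^sub>C T x + cnj c *\<^sub>C cadjoint T x)
        = c *\<^sub>C T (S x) + cnj c *\<^sub>C cadjoint T (S x)" .
  qed
  have "invariant_commuting G ?C"
  proof (rule invariant_commutingI)
    fix V A assume V: "V \<in> G" and A: "A \<in> ?C"
    have "V \<circ> B \<circ> cadjoint V \<in> M" if "B \<in> M" for B
      using MD(4)[OF cadjoint_in[OF V] that] by (simp add: cadjoint_cadjoint G_bounded V)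
    then show "cadjoint V \<circ> A \<circ> V \<in> ?C" by (rule conjugate_in_commutant[OF unitary[OF V] _ A])
  qed (use commutantD(1) C_adj C_comm in auto)
  moreover have "M \<subseteq> ?C" using MD by (auto intro!: commutantI)
  ultimately have CM: "?C = M" by (rule max)
  have "abelian_selfadjoint_algebra M"
    unfolding abelian_selfadjoint_algebra_def using C_alg MD(2,3) by (simp add: CM fun_eq_iff)
  moreover have "D = M" if D: "abelian_selfadjoint_algebra D" "M \<subseteq> D" for D
  proof -
    have "A \<in> ?C" if A: "A \<in> D" for A
    proof (rule commutantI)
      show "A \<in> bounded_operators"
        using D(1) A by (auto simp: abelian_selfadjoint_algebra_def operator_algebra_def)
      fix B x assume "B \<in> M"
      then have "A \<circ> B = B \<circ> A" using D A by (auto simp: abelian_selfadjoint_algebra_def)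
      then show "A (B x) = B (A x)" by (metis comp_apply)
    qed
    then show ?thesis using D(2) CM by blast
  qed
  ultimately have "masa M" unfolding masa_def by blast
  then show thesis using that CM base MD(4) by blast
qed

end

section \<open>The group generated by one unitary operator\<close>

inductive_set unitary_powers :: "('h::complex_hilbert_space \<Rightarrow> 'h) \<Rightarrow> ('h \<Rightarrow> 'h) set"
  for U where
  id: "id \<in> unitary_powers U"
| forward: "V \<in> unitary_powers U \<Longrightarrow> U \<circ> V \<in> unitary_powers U"
| backward: "V \<in> unitary_powers U \<Longrightarrow> cadjoint U \<circ> V \<in> unitary_powers U"

lemma unitary_powers_unitary:
  "V \<in> unitary_powers U \<Longrightarrow> unitary_operator U \<Longrightarrow> unitary_operator V"
  by (induction rule: unitary_powers.induct)
    (auto intro: unitary_operator_id unitary_operator_comp unitary_operator_cadjoint)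

lemma unitary_powers_comp:
  assumes "V \<in> unitary_powers U" "W \<in> unitary_powers U"
  shows "V \<circ> W \<in> unitary_powers U"
  using assms by (induction rule: unitary_powers.induct)
    (simp_all add: comp_assoc unitary_powers.forward unitary_powers.backward)

lemma unitary_powers_cadjoint:
  assumes "V \<in> unitary_powers U" "unitary_operator U"
  shows "cadjoint V \<in> unitary_powers U"
  using assms(1)
proof (rule unitary_powers.induct)
  note U = assms(2) and UD = unitary_operatorD(1)[OF assms(2)]
  show "cadjoint id \<in> unitary_powers U" by (simp only: cadjoint_id unitary_powers.id)
  fix V assume V: "V \<in> unitary_powers U" and IH: "cadjoint V \<in> unitary_powers U"
  note VD = unitary_operatorD(1)[OF unitary_powers_unitary[OF V U]]
  have "cadjoint U \<circ> id \<in> unitary_powers U" "U \<circ> id \<in> unitary_powers U"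
    by (intro unitary_powers.intros)+
  then have "cadjoint V \<circ> cadjoint U \<in> unitary_powers U" "cadjoint V \<circ> U \<in> unitary_powers U"
    using unitary_powers_comp[OF IH] by simp_all
  then show "cadjoint (U \<circ> V) \<in> unitary_powers U" "cadjoint (cadjoint U \<circ> V) \<in> unitary_powers U"
    by (simp_all only: cadjoint_comp[OF UD VD] cadjoint_comp[OF cadjoint_bounded[OF UD] VD]
        cadjoint_cadjoint[OF UD])
qed

lemma unitary_powers_commute:
  assumes U: "unitary_operator U" and "V \<in> unitary_powers U" "W \<in> unitary_powers U"
  shows "V (W x) = W (V x)"
proof -
  note UD = unitary_operatorD(2,3)[OF U]
  have gen: "U (W x) = W (U x) \<and> cadjoint U (W x) = W (cadjoint U x)"
    if "W \<in> unitary_powers U" for W x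
    using that by (induction arbitrary: x rule: unitary_powers.induct) (simp_all add: UD)
  show ?thesis
    using assms(2) by (induction arbitrary: x rule: unitary_powers.induct) (simp_all add: gen[OF assms(3)])
qed

section \<open>Invariant masas\<close>

theorem corollary2p7:
  fixes U :: "'h::complex_hilbert_space \<Rightarrow> 'h"
    and \<A> :: "('h \<Rightarrow> 'h) set"
  assumes "infinite_dimensional TYPE('h)"
    and "separable_space (euclidean :: 'h topology)"
    and "unitary_operator U"
    and "abelian_selfadjoint_algebra \<A>"
    and "conjugation_invariant U \<A>"
    and "\<A> = weak_operator_topology closure_of {A \<in> \<A>. compact_operator A}"
  shows "\<exists>\<B>. masa \<B> \<and> \<A> \<subseteq> \<B> \<and> conjugation_invariant U \<B>"
proof -
  note U = \<open>unitary_operator U\<close>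
  note UD = unitary_operatorD[OF U]
  have alg: "operator_algebra \<A>" and adj: "\<And>A. A \<in> \<A> \<Longrightarrow> cadjoint A \<in> \<A>"
    and comm: "\<And>A B. A \<in> \<A> \<Longrightarrow> B \<in> \<A> \<Longrightarrow> A \<circ> B = B \<circ> A"
    using assms(4) by (auto simp: abelian_selfadjoint_algebra_def)
  have bounded: "A \<in> bounded_operators" if "A \<in> \<A>" for A
    using alg that by (auto simp: operator_algebra_def)
  define \<alpha> where "\<alpha> = (\<lambda>T :: 'h \<Rightarrow> 'h. cadjoint U \<circ> T \<circ> U)"
  have \<alpha>_in: "\<alpha> A \<in> \<A>" if "A \<in> \<A>" for A
    using assms(5) that by (auto simp: conjugation_invariant_def \<alpha>_def)
  have \<alpha>_inverse: "\<alpha> (U \<circ> T \<circ> cadjoint U) = T" "U \<circ> \<alpha> T \<circ> cadjoint U = T" for T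
    by (simp_all add: \<alpha>_def fun_eq_iff UD)
  have \<alpha>_pow_in: "(\<alpha> ^^ n) A \<in> \<A>" if "A \<in> \<A>" for n A
    using that by (induction n) (simp_all add: \<alpha>_in)
  have \<alpha>_comp: "\<alpha> (S \<circ> T) = \<alpha> S \<circ> \<alpha> T" for S T
    by (simp add: \<alpha>_def fun_eq_iff UD)
  have \<alpha>_pow_comp: "(\<alpha> ^^ n) (S \<circ> T) = (\<alpha> ^^ n) S \<circ> (\<alpha> ^^ n) T" for n S T
  proof (induction n)
    case (Suc n)
    then show ?case by (simp only: funpow.simps(2) comp_apply[of \<alpha> "\<alpha> ^^ n"] \<alpha>_comp)
  qed simp
  have "inj \<alpha>" by (rule inj_on_inverseI) (rule \<alpha>_inverse(2))
  then have \<alpha>_pow_inj: "inj (\<alpha> ^^ n)" for n by (rule inj_fn)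
  \<comment> \<open>an element of \<open>\<A>\<close> need not be a value of \<open>\<alpha>\<close> on \<open>\<A>\<close>; allowing any number of iterates
    makes \<open>K\<close> invariant under the inverse of \<open>\<alpha>\<close> as well\<close>
  define K where "K = {T. hermitian T \<and> compact_on_sequences T \<and> (\<exists>n. (\<alpha> ^^ n) T \<in> \<A>)}"
  interpret unitary_group_on_compacts "unitary_powers U" K
  proof
    show "S (T x) = T (S x)" if S: "S \<in> K" and T: "T \<in> K" for S T x
    proof -
      obtain m n where "(\<alpha> ^^ m) S \<in> \<A>" "(\<alpha> ^^ n) T \<in> \<A>" using S T by (auto simp: K_def)
      then have "(\<alpha> ^^ (n + m)) S \<in> \<A>" "(\<alpha> ^^ (m + n)) T \<in> \<A>"
        using \<alpha>_pow_in by (simp_all only: funpow_add comp_apply)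
      then have "(\<alpha> ^^ (m + n)) (S \<circ> T) = (\<alpha> ^^ (m + n)) (T \<circ> S)"
        unfolding \<alpha>_pow_comp by (intro comm) (simp_all add: add.commute)
      then have "S \<circ> T = T \<circ> S" using \<alpha>_pow_inj by (rule injD[rotated])
      then show ?thesis by (metis comp_apply)
    qed
    have K_forward: "cadjoint U \<circ> T \<circ> U \<in> K" if T: "T \<in> K" for T
    proof -
      obtain n where "(\<alpha> ^^ n) T \<in> \<A>" using T by (auto simp: K_def)
      then have "(\<alpha> ^^ n) (\<alpha> T) \<in> \<A>" using \<alpha>_in by (simp add: funpow_swap1[symmetric])
      then show ?thesis
        using T hermitian_conjugate[OF U] compact_on_sequences_conjugate[OF U]
        unfolding K_def \<alpha>_def by blast
    qed
    have K_backward: "U \<circ> T \<circ> cadjoint U \<in> K" if T: "T \<in> K" for T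
    proof -
      note U' = unitary_operator_cadjoint[OF U]
      obtain n where "(\<alpha> ^^ n) T \<in> \<A>" using T by (auto simp: K_def)
      then have "(\<alpha> ^^ Suc n) (U \<circ> T \<circ> cadjoint U) \<in> \<A>"
        by (simp only: funpow_Suc_right comp_apply \<alpha>_inverse(1))
      moreover have "hermitian T" "compact_on_sequences T" using T by (auto simp: K_def)
      ultimately show ?thesis
        using hermitian_conjugate[OF U'] compact_on_sequences_conjugate[OF U']
        unfolding K_def cadjoint_cadjoint[OF UD(1)] by blast
    qed
    show "cadjoint V \<circ> T \<circ> V \<in> K" if "V \<in> unitary_powers U" "T \<in> K" for V T
    proof -
      have "\<forall>T\<in>K. cadjoint V \<circ> T \<circ> V \<in> K"
        using that(1)
      proof (rule unitary_powers.induct)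
        show "\<forall>T\<in>K. cadjoint id \<circ> T \<circ> id \<in> K" by (simp add: cadjoint_id)
        fix V assume V: "V \<in> unitary_powers U" and IH: "\<forall>T\<in>K. cadjoint V \<circ> T \<circ> V \<in> K"
        note VD = unitary_operatorD(1)[OF unitary_powers_unitary[OF V U]]
        have "cadjoint (U \<circ> V) \<circ> T \<circ> (U \<circ> V) = cadjoint V \<circ> (cadjoint U \<circ> T \<circ> U) \<circ> V" for T
          by (simp add: cadjoint_comp UD(1) VD comp_assoc)
        then show "\<forall>T\<in>K. cadjoint (U \<circ> V) \<circ> T \<circ> (U \<circ> V) \<in> K"
          using IH K_forward by metis
        have "cadjoint (cadjoint U \<circ> V) \<circ> T \<circ> (cadjoint U \<circ> V)
            = cadjoint V \<circ> (U \<circ> T \<circ> cadjoint U) \<circ> V" for T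
          by (simp add: cadjoint_comp cadjoint_bounded cadjoint_cadjoint UD(1) VD comp_assoc)
        then show "\<forall>T\<in>K. cadjoint (cadjoint U \<circ> V) \<circ> T \<circ> (cadjoint U \<circ> V) \<in> K"
          using IH K_backward by metis
      qed
      then show ?thesis using that(2) by blast
    qed
    show "hermitian T" "compact_on_sequences T" if "T \<in> K" for T
      using that by (simp_all add: K_def)
  qed (auto intro: unitary_powers_unitary[OF _ U] unitary_powers.id unitary_powers_comp
      unitary_powers_cadjoint[OF _ U] unitary_powers_commute[OF U])
  obtain \<B> where \<B>: "masa \<B>" "K \<subseteq> \<B>" "commutant \<B> = \<B>"
    and inv: "\<And>V A. V \<in> unitary_powers U \<Longrightarrow> A \<in> \<B> \<Longrightarrow> cadjoint V \<circ> A \<circ> V \<in> \<B>"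
    using invariant_masa_exists by blast
  have \<B>_bounded: "\<B> \<subseteq> bounded_operators"
    using commutantD(1)[of _ \<B>] \<B>(3) by auto
  have compacts: "A \<in> \<B>" if A: "A \<in> \<A>" and cpt: "compact_operator A" for A
  proof -
    have "A \<in> commutant \<B>"
    proof (rule commutantI)
      fix S x assume S: "S \<in> \<B>"
      have "S (A x) = A (S x)"
      proof (rule commutes_if_commutes_hermitian_parts[where S = S and A = A])
        fix c x
        let ?R = "\<lambda>x. c *\<^sub>C A x + cnj c *\<^sub>C cadjoint A x"
        have "?R \<in> \<A>" by (rule operator_algebra_combination[OF alg A adj[OF A]])
        then have "(\<alpha> ^^ 0) ?R \<in> \<A>" by simp
        then have "?R \<in> K"
          using hermitian_combination[OF bounded[OF A]]
            compact_combination_normal[OF bounded[OF A] compact_operator_imp_sequences[OF cpt]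
              comm[OF A adj[OF A]]]
          unfolding K_def by blast
        then have R: "?R \<in> \<B>" using \<B>(2) by blast
        have "S \<in> commutant \<B>" using S \<B>(3) by simp
        from commutantD(2)[OF this R, of x]
        show "S (c *\<^sub>C A x + cnj c *\<^sub>C cadjoint A x) = c *\<^sub>C A (S x) + cnj c *\<^sub>C cadjoint A (S x)" .
      qed (use S \<B>_bounded in blast)
      then show "A (S x) = S (A x)" by simp
    qed (rule bounded[OF A])
    then show ?thesis by (simp add: \<B>(3))
  qed
  have "weak_operator_topology closure_of {A \<in> \<A>. compact_operator A} \<subseteq> commutant \<B>"
    using compacts by (intro closure_of_minimal commutant_weakly_closed[OF \<B>_bounded]) (auto simp: \<B>(3))
  then have "\<A> \<subseteq> \<B>" using assms(6) \<B>(3) by simp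
  moreover have "U \<in> unitary_powers U"
    using unitary_powers.forward[OF unitary_powers.id, of U] by simp
  then have "conjugation_invariant U \<B>"
    using inv by (auto simp: conjugation_invariant_def)
  ultimately show ?thesis using \<B>(1) by blast
qed

end
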